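(* Let $r=2\sqrt3/3-1$. The compact packings of the plane using discs of radius $1$ and $r$ are exactly the packings obtained by starting with a triangular lattice packing by discs of radius $1$ and, for each hole in some nonempty subset of its holes, putting a disc of radius $r$ into the hole (tangent to the three discs bounding the hole).
   Context: A packing of the plane is a collection of closed discs in $\mathbb{R}^2$ with pairwise disjoint interiors. A packing is compact if for every disc $D$ of the packing, the discs of the packing tangent to $D$, listed in cyclic order around $D$ as $D_1,\dots,D_n$ (with $D_{n+1}=D_1$), are such that $D_i$ is tangent to $D_{i+1}$ for $i=1,\dots,n$, and this chain surrounds $D$: the angles, in $(0,\pi)$, at the centre of $D$ in the triangles with vertices the centres of $D,D_i,D_{i+1}$ sum to $2\pi$. A compact packing using discs of radius $1$ and $r$ is a compact packing in which every disc has radius $1$ or $r$ and discs of both radii occur. The triangular lattice packing is the packing by discs of radius $1$ in which each disc is tangent to six others. Its holes are the bounded regions enclosed by triples of mutually tangent discs (the components of the complement of the union of the discs). *)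

theory Defs
  imports "HOL-Analysis.Analysis"
begin

text \<open>The plane is the type \<^typ>\<open>complex\<close>, with its Euclidean metric and inner product.\<close>

datatype disc = Disc (centre: complex) (radius: real)

definition region :: "disc \<Rightarrow> complex set" where
  "region D = cball (centre D) (radius D)"

definition is_packing :: "disc set \<Rightarrow> bool" where
  "is_packing P \<longleftrightarrow> (\<forall>D\<in>P. 0 < radius D) \<and>
     pairwise (\<lambda>D E. disjnt (interior (region D)) (interior (region E))) P"

text \<open>Discs of a packing have disjoint interiors, so tangency is external tangency.\<close>

definition tangent :: "disc \<Rightarrow> disc \<Rightarrow> bool" where
  "tangent D E \<longleftrightarrow> dist (centre D) (centre E) = radius D + radius E"

definition tangent_discs :: "disc set \<Rightarrow> disc \<Rightarrow> disc set" where
  "tangent_discs P D = {E \<in> P. tangent D E}"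

definition angle_at :: "complex \<Rightarrow> complex \<Rightarrow> complex \<Rightarrow> real" where
  "angle_at c a b = arccos (((a - c) \<bullet> (b - c)) / (norm (a - c) * norm (b - c)))"

text \<open>The points of the list are met in this order when turning counterclockwise once
  around \<open>c\<close>; the function \<open>\<theta>\<close> gives their polar angles.\<close>

definition cyclic_order :: "complex \<Rightarrow> complex list \<Rightarrow> bool" where
  "cyclic_order c zs \<longleftrightarrow> (\<exists>\<theta> :: nat \<Rightarrow> real.
     (\<forall>i < length zs. zs ! i - c = of_real (dist c (zs ! i)) * cis (\<theta> i)) \<and>
     (\<forall>i j. i < j \<and> j < length zs \<longrightarrow> \<theta> i < \<theta> j \<and> \<theta> j < \<theta> i + 2 * pi))"

text \<open>A list \<open>Ds\<close> as below stands for the chain \<open>D\<^sub>1, \<dots>, D\<^sub>n\<close>, indexed from 0 and modulo its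
  length. Consecutive members are tangent to each other and to \<open>D\<close>, so the triangles are
  nondegenerate and the angles lie strictly between 0 and \<open>\<pi>\<close>.\<close>

definition surrounds :: "disc list \<Rightarrow> disc \<Rightarrow> bool" where
  "surrounds Ds D \<longleftrightarrow>
     (\<Sum>i < length Ds. angle_at (centre D) (centre (Ds ! i))
        (centre (Ds ! (Suc i mod length Ds)))) = 2 * pi"

definition compact_packing :: "disc set \<Rightarrow> bool" where
  "compact_packing P \<longleftrightarrow> is_packing P \<and>
     (\<forall>D\<in>P. \<exists>Ds. distinct Ds \<and> set Ds = tangent_discs P D \<and>
        cyclic_order (centre D) (map centre Ds) \<and>
        (\<forall>i < length Ds. tangent (Ds ! i) (Ds ! (Suc i mod length Ds))) \<and>
        surrounds Ds D)"

definition compact_packing_using :: "real \<Rightarrow> real \<Rightarrow> disc set \<Rightarrow> bool" where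
  "compact_packing_using s r P \<longleftrightarrow> compact_packing P \<and> radius ` P = {s, r}"

text \<open>The condition below determines the packing up to rigid motions of the plane.\<close>

definition triangular_lattice_packing :: "disc set \<Rightarrow> bool" where
  "triangular_lattice_packing T \<longleftrightarrow> is_packing T \<and> T \<noteq> {} \<and> (\<forall>D\<in>T. radius D = 1) \<and>
     (\<forall>D\<in>T. card (tangent_discs T D) = 6)"

definition bounding_discs :: "disc set \<Rightarrow> complex set \<Rightarrow> disc set" where
  "bounding_discs T H = {D \<in> T. region D \<inter> frontier H \<noteq> {}}"

definition holes :: "disc set \<Rightarrow> complex set set" where
  "holes T = {H \<in> components (- (\<Union>D\<in>T. region D)). bounded H \<and>
     (\<exists>A B C. tangent A B \<and> tangent B C \<and> tangent A C \<and> bounding_discs T H = {A, B, C})}"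

text \<open>A hole is an open set, so the inserted closed disc, which touches the boundary of the
  hole, lies in it only up to its own boundary.\<close>

definition put_into_hole :: "disc set \<Rightarrow> complex set \<Rightarrow> disc \<Rightarrow> bool" where
  "put_into_hole T H D \<longleftrightarrow> interior (region D) \<subseteq> H \<and> (\<forall>E \<in> bounding_discs T H. tangent D E)"

text \<open>\<open>S\<close> is the set of holes that receive a disc of radius \<open>r\<close>; \<open>f H\<close> is the disc put into \<open>H\<close>.\<close>

definition filled_packing :: "real \<Rightarrow> disc set \<Rightarrow> complex set set \<Rightarrow> disc set \<Rightarrow> bool" where
  "filled_packing r T S P \<longleftrightarrow>
     (\<exists>f. (\<forall>H\<in>S. radius (f H) = r \<and> put_into_hole T H (f H)) \<and> P = T \<union> f ` S)"

end

theory Submission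
  imports Defs
begin

text \<open>At a disc of radius \<open>r\<close> two unit neighbours subtend \<open>2\<pi>/3\<close>, two small ones \<open>\<pi>/3\<close>, and a mixed
  pair an angle between \<open>4\<pi>/9\<close> and \<open>\<pi>/2\<close>; since these sum to \<open>2\<pi>\<close>, no mixed pair occurs. Six small
  neighbours would propagate to a triangular lattice of small discs covering the plane, so every small
  disc has exactly three unit neighbours and sits in a hole. At a unit disc the angles are \<open>\<pi>/3\<close>
  (two unit neighbours) and \<open>\<pi>/6\<close> (mixed pair), so the unit neighbours form a regular hexagon.
  Conversely, six unit neighbours at mutual angles at least \<open>\<pi>/3\<close> are equally spaced, and a disc put
  into a hole is centred at the barycentre of the three centres around it.\<close>

section \<open>Neighbours in cyclic order\<close>

text \<open>The definition of compactness speaks of lists, cyclic indices and \<open>arccos\<close>,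
  which sees neither orientation nor turns beyond \<pi>. The proof trades these for directions:
  \<open>touches D v E\<close> records a neighbour by a unit vector, so turning about
  \<open>D\<close> becomes multiplication by \<open>cis\<close>. A chain yields, for each neighbour,
  a next one at a known turn. Conversely, if there are finitely many neighbours and each has a next
  one at a turn below \<pi> with nothing strictly between, they form a chain. Holes are components
  of a complement and awkward to compute with. The proof works instead with \<open>pocket\<close>: a
  small disc touching three unit discs at turns of 120 degrees. A single topological argument turns
  a pocket into a hole; in the other direction tangency to the bounding discs gives a pocket, and
  disjointness of components keeps the inserted discs apart. Metrically,
  \<open>tau = 1 + rho\<close> is the circumradius of the equilateral triangle of side 2, and
  \<open>tau\<^sup>2 = 4 / 3\<close> drives most distance computations.\<close>

lemma packing_radius_pos: "is_packing P \<Longrightarrow> D \<in> P \<Longrightarrow> 0 < radius D"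
  by (simp add: is_packing_def)

text \<open>Were the centres closer, the point dividing their segment in the ratio of the radii
  would be interior to both discs.\<close>

lemma packing_dist_ge:
  assumes P: "is_packing P" "D \<in> P" "E \<in> P" "D \<noteq> E"
  shows "radius D + radius E \<le> dist (centre D) (centre E)"
proof (rule ccontr)
  define c d x y where "c = centre D" and "d = centre E" and "x = radius D" and "y = radius E"
  assume "\<not> ?thesis"
  then have lt: "dist c d < x + y" by (simp add: c_def d_def x_def y_def)
  have pos: "0 < x" "0 < y" using packing_radius_pos P by (auto simp: x_def y_def)
  define p where "p = c + of_real (x / (x + y)) * (d - c)"
  have cd: "norm (d - c) < x + y" using lt by (simp add: dist_norm norm_minus_commute)
  have 1: "dist c p < x"
  proof -
    have "dist c p = (x / (x + y)) * norm (d - c)"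
      using pos by (simp add: p_def dist_norm norm_mult del: of_real_divide of_real_add)
    also have "\<dots> < (x / (x + y)) * (x + y)"
      using pos cd by (intro mult_strict_left_mono) auto
    finally show ?thesis using pos by simp
  qed
  have 2: "dist d p < y"
  proof -
    have "d - p = of_real (y / (x + y)) * (d - c)"
    proof -
      have "1 - complex_of_real (x / (x + y)) = of_real (1 - x / (x + y))" by simp
      also have "1 - x / (x + y) = y / (x + y)" using pos by (simp add: field_simps)
      finally have "of_real (y / (x + y)) * (d - c) = (1 - complex_of_real (x / (x + y))) * (d - c)"
        by simp
      then show ?thesis by (simp add: p_def algebra_simps)
    qed
    then have "dist d p = (y / (x + y)) * norm (d - c)"
      using pos by (simp add: dist_norm norm_mult del: of_real_divide of_real_add)
    also have "\<dots> < (y / (x + y)) * (x + y)"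
      using pos cd by (intro mult_strict_left_mono) auto
    finally show ?thesis using pos by simp
  qed
  have "disjnt (interior (region D)) (interior (region E))"
    using P by (auto simp: is_packing_def pairwise_def)
  then show False
    using 1 2 by (auto simp: region_def disjnt_iff c_def d_def x_def y_def)
qed

lemma packing_eqI:
  assumes "is_packing P" "D \<in> P" "E \<in> P" "dist (centre D) (centre E) < radius D + radius E"
  shows "D = E"
  using packing_dist_ge[of P D E] assms by force

lemma tangent_sym: "tangent D E \<longleftrightarrow> tangent E D"
  by (simp add: tangent_def dist_commute add.commute)

lemma norm_tangent: "tangent D E \<Longrightarrow> norm (centre E - centre D) = radius D + radius E"
  by (simp add: tangent_def dist_norm norm_minus_commute)

lemma disc_eqI: "centre D = centre E \<Longrightarrow> radius D = radius E \<Longrightarrow> D = E"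
  by (cases D; cases E) auto

section \<open>Angles at a disc and turns between consecutive neighbours\<close>

lemma angle_at_polar:
  assumes "0 < a" "0 < b"
  shows "angle_at c (c + of_real a * cis s) (c + of_real b * cis t) = arccos (cos (t - s))"
proof -
  have "(of_real a * cis s) \<bullet> (of_real b * cis t) = (a * b) * cos (t - s)"
    by (simp add: inner_complex_def cos_diff algebra_simps)
  then show ?thesis using assms by (simp add: angle_at_def norm_mult)
qed

text \<open>The law of cosines: the sides of the triangle are sums of radii, so the angle depends on
  the three radii alone.\<close>

lemma angle_at_tangent:
  assumes "tangent D E" "tangent D F" "tangent E F" "0 < radius D" "0 < radius E" "0 < radius F"
  shows "angle_at (centre D) (centre E) (centre F) =
    arccos (((radius D + radius E)\<^sup>2 + (radius D + radius F)\<^sup>2 - (radius E + radius F)\<^sup>2) /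
      (2 * (radius D + radius E) * (radius D + radius F)))"
proof -
  let ?a = "centre E - centre D" and ?b = "centre F - centre D"
  have n: "norm ?a = radius D + radius E" "norm ?b = radius D + radius F"
    using assms norm_tangent by auto
  have "norm (?a - ?b) = radius E + radius F"
    using assms(3) by (simp add: tangent_def dist_norm)
  then have q: "?a \<bullet> ?b = ((radius D + radius E)\<^sup>2 + (radius D + radius F)\<^sup>2 - (radius E + radius F)\<^sup>2) / 2"
    using n dot_norm_neg[of ?a ?b] by simp
  show ?thesis
    unfolding angle_at_def n q by (simp only: divide_divide_eq_left mult.assoc)
qed

text \<open>Compares the angles in \<open>surrounds\<close> with the turns in
  \<open>cyclic_order\<close>; a turn beyond \<pi> exceeds every value of
  \<open>arccos\<close>.\<close>

lemma arccos_cos_le: "0 \<le> x \<Longrightarrow> arccos (cos x) \<le> x"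
proof (cases "x \<le> pi")
  case False
  then show ?thesis using arccos_ubound[of "cos x"] by (simp add: abs_le_iff)
qed (simp add: arccos_cos)

text \<open>The last gap closes the circle.\<close>

definition gap :: "(nat \<Rightarrow> real) \<Rightarrow> nat \<Rightarrow> nat \<Rightarrow> real" where
  "gap \<theta> n i = (if Suc i < n then \<theta> (Suc i) - \<theta> i else \<theta> 0 + 2 * pi - \<theta> i)"

lemma sum_gap:
  assumes "0 < n"
  shows "(\<Sum>i<n. gap \<theta> n i) = 2 * pi"
proof -
  obtain m where m: "n = Suc m" using assms gr0_implies_Suc by blast
  have "(\<Sum>i<m. gap \<theta> n i) = (\<Sum>i<m. \<theta> (Suc i) - \<theta> i)"
    by (rule sum.cong) (auto simp: gap_def m)
  also have "\<dots> = \<theta> m - \<theta> 0" by (rule sum_lessThan_telescope)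
  finally show ?thesis by (simp add: m) (simp add: gap_def)
qed

lemma cis_gap: "i < n \<Longrightarrow> cis (\<theta> (Suc i mod n)) = cis (\<theta> i + gap \<theta> n i)"
proof (cases "Suc i < n")
  case False
  moreover assume "i < n"
  ultimately have "Suc i = n" by simp
  then show ?thesis by (simp add: gap_def cis_mult[symmetric])
qed (simp add: gap_def)

lemma gap_pos:
  assumes "\<forall>i j. i < j \<and> j < n \<longrightarrow> \<theta> i < \<theta> j \<and> \<theta> j < \<theta> i + 2 * pi" "i < n"
  shows "0 < gap \<theta> n i"
proof (cases "Suc i < n")
  case False
  then show ?thesis using assms by (cases "i = 0") (auto simp: gap_def dest: spec[of _ 0])
qed (use assms in \<open>auto simp: gap_def\<close>)

lemma angle_at_gap:
  assumes "\<And>i. i < n \<Longrightarrow> zs i = c + of_real (\<rho> i) * cis (\<theta> i)" "\<And>i. i < n \<Longrightarrow> 0 < \<rho> i" "i < n"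
  shows "angle_at c (zs i) (zs (Suc i mod n)) = arccos (cos (gap \<theta> n i))"
proof -
  have *: "Suc i mod n < n" using assms(3) by simp
  have "zs (Suc i mod n) = c + of_real (\<rho> (Suc i mod n)) * cis (\<theta> i + gap \<theta> n i)"
    using assms(1)[OF *] cis_gap[OF assms(3)] by simp
  then show ?thesis
    using assms(1)[OF assms(3)] angle_at_polar[OF assms(2)[OF assms(3)] assms(2)[OF *], of c "\<theta> i"]
    by simp
qed

text \<open>A gap between consecutive polar angles could exceed \<pi>, and then the triangle would
  have a smaller angle; the surrounding condition excludes this. The triangle angle is therefore the
  true counterclockwise turn to the next neighbour, as the equation between the values of
  \<open>cis\<close> records.\<close>

lemma compact_packing_chain:
  assumes "compact_packing P" "D \<in> P"
  obtains Ds \<theta> where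
    "set Ds = tangent_discs P D" "Ds \<noteq> []"
    "\<And>i. i < length Ds \<Longrightarrow> tangent (Ds ! i) (Ds ! (Suc i mod length Ds))"
    "\<And>i. i < length Ds \<Longrightarrow>
       centre (Ds ! i) = centre D + of_real (radius D + radius (Ds ! i)) * cis (\<theta> i)"
    "\<And>i. i < length Ds \<Longrightarrow> cis (\<theta> (Suc i mod length Ds)) =
       cis (\<theta> i + angle_at (centre D) (centre (Ds ! i)) (centre (Ds ! (Suc i mod length Ds))))"
    "(\<Sum>i < length Ds. angle_at (centre D) (centre (Ds ! i))
        (centre (Ds ! (Suc i mod length Ds)))) = 2 * pi"
proof -
  have P: "is_packing P" using assms by (simp add: compact_packing_def)
  obtain Ds where Ds: "set Ds = tangent_discs P D" "cyclic_order (centre D) (map centre Ds)"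
    "\<forall>i < length Ds. tangent (Ds ! i) (Ds ! (Suc i mod length Ds))" "surrounds Ds D"
    using assms by (auto simp: compact_packing_def)
  define n where "n = length Ds"
  obtain \<theta> where \<theta>: "\<forall>i<n. centre (Ds ! i) - centre D = of_real (dist (centre D) (centre (Ds ! i))) * cis (\<theta> i)"
    "\<forall>i j. i < j \<and> j < n \<longrightarrow> \<theta> i < \<theta> j \<and> \<theta> j < \<theta> i + 2 * pi"
    using Ds(2) by (auto simp: cyclic_order_def n_def)
  have mem: "Ds ! i \<in> P \<and> tangent D (Ds ! i)" if "i < n" for i
    using that Ds(1) nth_mem[of i Ds] by (auto simp: n_def tangent_discs_def)
  have c: "centre (Ds ! i) = centre D + of_real (radius D + radius (Ds ! i)) * cis (\<theta> i)" if "i < n" for i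
    using that \<theta>(1) mem[OF that] by (metis add.commute diff_add_cancel tangent_def)
  have s: "(\<Sum>i<n. angle_at (centre D) (centre (Ds ! i)) (centre (Ds ! (Suc i mod n)))) = 2 * pi"
    using Ds(4) by (simp add: surrounds_def n_def)
  \<comment> \<open>An empty chain has angle sum 0, so the surrounding condition also supplies a
    neighbour.\<close>
  have ne: "0 < n" using s by (cases n) auto
  have a: "angle_at (centre D) (centre (Ds ! i)) (centre (Ds ! (Suc i mod n))) = arccos (cos (gap \<theta> n i))"
    if "i < n" for i
    using that c mem packing_radius_pos[OF P] assms(2)
    by (intro angle_at_gap[where zs = "\<lambda>i. centre (Ds ! i)" and \<rho> = "\<lambda>i. radius D + radius (Ds ! i)"])
       (auto intro: add_pos_pos)
  have le: "angle_at (centre D) (centre (Ds ! i)) (centre (Ds ! (Suc i mod n))) \<le> gap \<theta> n i" if "i < n" for i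
    using a[OF that] gap_pos[OF \<theta>(2) that] arccos_cos_le by simp
  \<comment> \<open>Each angle is at most the corresponding gap and both families sum to \<open>2\<pi>\<close>.\<close>
  have eq: "angle_at (centre D) (centre (Ds ! i)) (centre (Ds ! (Suc i mod n))) = gap \<theta> n i" if "i < n" for i
  proof (rule ccontr)
    assume "\<not> ?thesis"
    then have "angle_at (centre D) (centre (Ds ! i)) (centre (Ds ! (Suc i mod n))) < gap \<theta> n i"
      using le[OF that] by simp
    then have "(\<Sum>i<n. angle_at (centre D) (centre (Ds ! i)) (centre (Ds ! (Suc i mod n)))) < (\<Sum>i<n. gap \<theta> n i)"
      using that le by (intro sum_strict_mono_ex1) auto
    then show False using s sum_gap[OF ne] by simp
  qed
  show thesis
  proof (rule that[of Ds \<theta>])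
    show "Ds \<noteq> []" using ne by (auto simp: n_def)
    show "cis (\<theta> (Suc i mod length Ds)) =
       cis (\<theta> i + angle_at (centre D) (centre (Ds ! i)) (centre (Ds ! (Suc i mod length Ds))))"
      if "i < length Ds" for i
      using that eq[of i] cis_gap[of i n \<theta>] unfolding n_def by metis
  qed (use Ds c s in \<open>simp_all add: n_def\<close>)
qed

text \<open>\<open>v\<close> is the direction from \<open>D\<close> to \<open>E\<close> as a complex
  unit. For positive radii this is tangency together with its direction.\<close>

definition touches :: "disc \<Rightarrow> complex \<Rightarrow> disc \<Rightarrow> bool" where
  "touches D v E \<longleftrightarrow> norm v = 1 \<and> centre E = centre D + of_real (radius D + radius E) * v"

lemma touches_tangent: "touches D v E \<Longrightarrow> 0 < radius D \<Longrightarrow> 0 < radius E \<Longrightarrow> tangent D E"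
  by (simp add: touches_def tangent_def dist_norm norm_mult del: of_real_add)

lemma of_real_add_nonzero: "0 < x \<Longrightarrow> 0 < y \<Longrightarrow> complex_of_real (x + y) \<noteq> 0"
  by (metis add_pos_pos less_irrefl of_real_eq_0_iff)

lemma tangent_touches:
  assumes "tangent D E" "0 < radius D" "0 < radius E"
  shows "\<exists>v. touches D v E"
proof
  have "complex_of_real (radius D + radius E) \<noteq> 0"
    using assms(2,3) of_real_add_nonzero by blast
  then show "touches D ((centre E - centre D) / of_real (radius D + radius E)) E"
    using norm_tangent[OF assms(1)] assms(2,3)
    by (simp add: touches_def norm_divide del: of_real_add)
qed

lemma touches_unique:
  assumes "touches D v E" "touches D w E" "0 < radius D" "0 < radius E"
  shows "v = w"
proof -
  have "complex_of_real (radius D + radius E) \<noteq> 0"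
    using assms(3,4) of_real_add_nonzero by blast
  then show ?thesis using assms(1,2) by (simp add: touches_def del: of_real_add)
qed

text \<open>The successor of \<open>E\<close> in the chain. It allows walking around
  \<open>D\<close> by multiplying directions, without mentioning lists or indices.\<close>

lemma next_neighbour:
  assumes "compact_packing P" "D \<in> P" "E \<in> P" "touches D v E"
  shows "\<exists>F\<in>P. tangent D F \<and> tangent E F \<and>
    touches D (v * cis (angle_at (centre D) (centre E) (centre F))) F"
proof -
  have P: "is_packing P" using assms by (simp add: compact_packing_def)
  have pos: "0 < radius D" "0 < radius E" using packing_radius_pos[OF P] assms by auto
  obtain Ds \<theta> where Ds:
    "set Ds = tangent_discs P D" "Ds \<noteq> []"
    "\<And>i. i < length Ds \<Longrightarrow> tangent (Ds ! i) (Ds ! (Suc i mod length Ds))"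
    "\<And>i. i < length Ds \<Longrightarrow>
       centre (Ds ! i) = centre D + of_real (radius D + radius (Ds ! i)) * cis (\<theta> i)"
    "\<And>i. i < length Ds \<Longrightarrow> cis (\<theta> (Suc i mod length Ds)) =
       cis (\<theta> i + angle_at (centre D) (centre (Ds ! i)) (centre (Ds ! (Suc i mod length Ds))))"
    by (rule compact_packing_chain[OF assms(1,2)]) blast
  have "E \<in> set Ds" using assms touches_tangent[OF assms(4) pos] by (simp add: Ds(1) tangent_discs_def)
  then obtain i where i: "i < length Ds" "E = Ds ! i" by (auto simp: in_set_conv_nth)
  define j where "j = Suc i mod length Ds"
  have j: "j < length Ds" using mod_less_divisor[of "length Ds" "Suc i"] Ds(2) by (simp add: j_def)
  then have F: "Ds ! j \<in> P" "tangent D (Ds ! j)"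
    using Ds(1) nth_mem[of j Ds] by (auto simp: tangent_discs_def)
  have "touches D (cis (\<theta> i)) E" using Ds(4)[OF i(1)] i(2) by (simp add: touches_def)
  then have "v = cis (\<theta> i)" using touches_unique assms(4) pos by blast
  then have "touches D (v * cis (angle_at (centre D) (centre E) (centre (Ds ! j)))) (Ds ! j)"
    using Ds(4)[OF j] Ds(5)[OF i(1)] i(2) by (simp add: touches_def cis_mult j_def)
  then show ?thesis using F Ds(3)[OF i(1)] i(2) unfolding j_def by blast
qed

lemma neighbour_exists:
  assumes "compact_packing P" "D \<in> P"
  shows "\<exists>E\<in>P. tangent D E"
proof -
  obtain Ds where "set Ds = tangent_discs P D" "Ds \<noteq> []"
    by (rule compact_packing_chain[OF assms]) blast
  then show ?thesis by (cases Ds) (auto simp: tangent_discs_def)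
qed


section \<open>Rebuilding a chain from a rule for next neighbours\<close>

lemma cis_eqD:
  assumes "cis a = cis b" "\<bar>a - b\<bar> < 4 * pi"
  shows "a = b \<or> a = b + 2 * pi \<or> a = b - 2 * pi"
proof -
  have "sin a = sin b \<and> cos a = cos b" using assms(1) by (simp add: complex_eq_iff)
  then obtain n :: int where n: "a = b + 2 * pi * n" using sin_cos_eq_iff by blast
  then have "\<bar>2 * pi * real_of_int n\<bar> < 4 * pi" using assms(2) by simp
  then have "2 * pi * \<bar>real_of_int n\<bar> < 2 * pi * 2" by (simp add: abs_mult)
  then have "\<bar>real_of_int n\<bar> < 2" using mult_less_cancel_left_pos[of "2 * pi"] by simp
  then have "n = 0 \<or> n = 1 \<or> n = -1" by linarith
  then show ?thesis using n by auto
qed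

text \<open>The cyclic successor of \<open>xs ! i\<close> is itself an entry, so its gap is not
  below \<delta>. A gap above \<delta> would put \<open>y\<close> strictly between two consecutive
  entries, or on the arc leading from the last entry round to the first.\<close>

lemma sorted_next:
  fixes xs :: "real list"
  assumes xs: "sorted_wrt (<) xs" "set xs \<subseteq> {0..<2 * pi}" and i: "i < length xs"
    and y: "y \<in> set xs" "cis y = cis (xs ! i + \<delta>)" and \<delta>: "0 < \<delta>" "\<delta> < 2 * pi"
    and between: "\<And>z \<epsilon>. z \<in> set xs \<Longrightarrow> 0 < \<epsilon> \<Longrightarrow> \<epsilon> < \<delta> \<Longrightarrow> cis z \<noteq> cis (xs ! i + \<epsilon>)"
  shows "xs ! (Suc i mod length xs) = y" "gap ((!) xs) (length xs) i = \<delta>"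
proof -
  define n where "n = length xs"
  define z where "z = xs ! (Suc i mod n)"
  define \<epsilon> where "\<epsilon> = gap ((!) xs) n i"
  have inn: "i < n" "Suc i mod n < n" using i mod_less_divisor[of n "Suc i"] unfolding n_def by linarith+
  have less: "xs ! j < xs ! k" if "j < k" "k < n" for j k
    using xs(1) that by (simp add: sorted_wrt_iff_nth_less n_def)
  have rng: "0 \<le> xs ! j \<and> xs ! j < 2 * pi" if "j < n" for j
    using subsetD[OF xs(2) nth_mem[of j xs]] that by (simp add: n_def)
  have zin: "z \<in> set xs" using inn by (simp add: z_def n_def)
  have cz: "cis z = cis (xs ! i + \<epsilon>)" unfolding z_def \<epsilon>_def using cis_gap[OF inn(1)] .
  have "0 < \<epsilon>"
    unfolding \<epsilon>_def
  proof (rule gap_pos[OF _ inn(1)], intro allI impI, elim conjE)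
    fix j k assume "j < k" "k < n"
    then show "xs ! j < xs ! k \<and> xs ! k < xs ! j + 2 * pi"
      using less rng[of j] rng[of k] by force
  qed
  then have ge: "\<delta> \<le> \<epsilon>" using between[OF zin] cz by force
  obtain j where j: "j < n" "y = xs ! j" using y(1) by (auto simp: in_set_conv_nth n_def)
  \<comment> \<open>Both entries lie in \<open>[0, 2 * pi)\<close>, so the turn \<delta> passes the
    polar angle 0 at most once.\<close>
  have cases: "y = xs ! i + \<delta> \<or> y = xs ! i + \<delta> - 2 * pi"
    using cis_eqD[OF y(2)] rng[OF j(1)] rng[OF inn(1)] \<delta> j(2) by auto
  have le: "\<epsilon> \<le> \<delta>"
  proof (rule ccontr)
    assume "\<not> ?thesis"
    then have lt: "\<delta> < \<epsilon>" by simp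
    show False
    proof (cases "Suc i < n")
      case True
      then have \<epsilon>: "\<epsilon> = xs ! Suc i - xs ! i" by (simp add: \<epsilon>_def gap_def)
      from cases have "y = xs ! i + \<delta>"
        using lt \<epsilon> rng[OF True] rng[OF j(1)] j(2) by auto
      then have "xs ! i < xs ! j" "xs ! j < xs ! Suc i" using lt \<epsilon> \<delta> j by auto
      then have "i < j" "j < Suc i"
        using less[of j i] less[of "Suc i" j] inn j(1) True
        by (metis linorder_neqE_nat order_less_asym)+
      then show False by simp
    next
      case False
      then have \<epsilon>: "\<epsilon> = xs ! 0 + 2 * pi - xs ! i" and last: "Suc i = n"
        using inn by (auto simp: \<epsilon>_def gap_def)
      from cases show False
      proof
        assume "y = xs ! i + \<delta>"
        then have "\<not> j \<le> i" using less[of j i] inn \<delta> j by (cases "j = i") auto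
        then show False using j last by simp
      next
        assume "y = xs ! i + \<delta> - 2 * pi"
        then have "xs ! j < xs ! 0" using lt \<epsilon> j by simp
        then show False using less[of 0 j] j by (cases "j = 0") auto
      qed
    qed
  qed
  with ge have eq: "\<epsilon> = \<delta>" by simp
  then show "gap ((!) xs) (length xs) i = \<delta>" by (simp add: \<epsilon>_def n_def)
  have "cis z = cis y" using cz y(2) eq by simp
  then have "z = y"
    using cis_eqD[of z y] rng[OF inn(2)] rng[OF j(1)] j(2) by (auto simp: z_def)
  then show "xs ! (Suc i mod length xs) = y" by (simp add: z_def n_def)
qed

lemma Arg2pi_polar: "z = of_real (norm z) * cis (Arg2pi z)"
  by (metis Arg2pi_eq cis_conv_exp)

lemma Arg2pi_range: "Arg2pi z \<in> {0..<2 * pi}"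
  using Arg2pi_ge_0[of z] Arg2pi_lt_2pi[of z] by simp

text \<open>Two discs touching \<open>D\<close> from the same direction have centres at distance the
  difference of their radii, which is less than the sum, so they overlap.\<close>

lemma touches_inj:
  assumes P: "is_packing P" "E \<in> P" "F \<in> P" and "touches D v E" "touches D v F"
  shows "E = F"
proof (rule packing_eqI[OF P])
  have v: "norm v = 1" using assms(4) by (simp add: touches_def)
  have "centre E - centre F = of_real (radius E - radius F) * v"
    using assms(4,5) by (simp add: touches_def algebra_simps)
  then have "dist (centre E) (centre F) = \<bar>radius E - radius F\<bar>"
    by (simp add: dist_norm norm_mult v del: of_real_diff)
  then show "dist (centre E) (centre F) < radius E + radius F"
    using packing_radius_pos[OF P(1)] P(2,3) by (force simp: abs_less_iff)
qed

text \<open>Sorting the neighbours by polar angle gives the list, and \<open>sorted_next\<close>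
  identifies each cyclic successor with the disc supplied by the rule. The bound
  \<open>\<delta> < pi\<close> makes every triangle angle equal to its gap, and the gaps sum to
  \<open>2 * pi\<close>.\<close>

lemma compact_chainI:
  assumes P: "is_packing P" "D \<in> P" and fin: "finite (tangent_discs P D)" and ne: "tangent_discs P D \<noteq> {}"
    and step: "\<And>E v. E \<in> P \<Longrightarrow> touches D v E \<Longrightarrow>
      \<exists>F\<in>P. \<exists>\<delta>. 0 < \<delta> \<and> \<delta> < pi \<and> tangent E F \<and> touches D (v * cis \<delta>) F \<and>
        (\<forall>G\<in>P. \<forall>\<epsilon>. 0 < \<epsilon> \<and> \<epsilon> < \<delta> \<longrightarrow> \<not> touches D (v * cis \<epsilon>) G)"
  shows "\<exists>Ds. distinct Ds \<and> set Ds = tangent_discs P D \<and>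
        cyclic_order (centre D) (map centre Ds) \<and>
        (\<forall>i < length Ds. tangent (Ds ! i) (Ds ! (Suc i mod length Ds))) \<and>
        surrounds Ds D"
proof -
  let ?N = "tangent_discs P D"
  define \<phi> where "\<phi> E = Arg2pi (centre E - centre D)" for E
  have pos: "0 < radius D + radius E" if "E \<in> P" for E
    using packing_radius_pos[OF P(1)] that P(2) by (simp add: add_pos_pos)
  have polar: "centre E = centre D + of_real (radius D + radius E) * cis (\<phi> E)" if "E \<in> ?N" for E
    using that Arg2pi_polar[of "centre E - centre D"] norm_tangent[of D E]
    unfolding \<phi>_def tangent_discs_def by (metis (no_types, lifting) add.commute diff_add_cancel mem_Collect_eq)
  have memN: "G \<in> ?N" if "G \<in> P" "centre G = centre D + of_real (radius D + radius G) * cis a" for G a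
    using that pos[OF that(1)] by (simp add: tangent_discs_def tangent_def dist_norm norm_mult del: of_real_add)
  have inj: "inj_on \<phi> ?N"
  proof (rule inj_onI)
    fix E F assume "E \<in> ?N" "F \<in> ?N" "\<phi> E = \<phi> F"
    then show "E = F"
      using touches_inj[OF P(1), of E F D "cis (\<phi> E)"] polar[of E] polar[of F]
      by (simp add: touches_def tangent_discs_def)
  qed
  \<comment> \<open>Polar angles determine neighbours, so the discs can be read back from the sorted
    list of angles.\<close>
  define xs where "xs = sorted_list_of_set (\<phi> ` ?N)"
  define Ds where "Ds = map (inv_into ?N \<phi>) xs"
  have xs: "sorted_wrt (<) xs" "set xs = \<phi> ` ?N" using fin by (auto simp: xs_def)
  have rng: "set xs \<subseteq> {0..<2 * pi}" using xs(2) Arg2pi_range by (auto simp: \<phi>_def)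
  define n where "n = length xs"
  have lenDs: "length Ds = n" by (simp add: Ds_def n_def)
  have n0: "0 < n" using ne xs(2) by (auto simp: n_def)
  have Dsi: "Ds ! i \<in> ?N \<and> \<phi> (Ds ! i) = xs ! i" if "i < n" for i
  proof -
    have "xs ! i \<in> \<phi> ` ?N" using that xs(2) nth_mem[of i xs] by (auto simp: n_def)
    then show ?thesis using that by (simp add: Ds_def n_def inv_into_into f_inv_into_f)
  qed
  have setDs: "set Ds = ?N"
    using xs(2) inj by (simp add: Ds_def inv_into_image_cancel)
  have dist: "distinct Ds"
    using strict_sorted_iff xs inj by (auto simp: Ds_def distinct_map inj_on_inv_into xs_def)
  have c: "centre (Ds ! i) = centre D + of_real (radius D + radius (Ds ! i)) * cis (xs ! i)"
    if "i < n" for i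
    using polar[of "Ds ! i"] Dsi[OF that] by simp
  have nxt: "tangent (Ds ! i) (Ds ! (Suc i mod n)) \<and> 0 < gap ((!) xs) n i \<and> gap ((!) xs) n i < pi"
    if i: "i < n" for i
  proof -
    have "Ds ! i \<in> P" using Dsi[OF i] by (simp add: tangent_discs_def)
    moreover have "touches D (cis (xs ! i)) (Ds ! i)" using c[OF i] by (simp add: touches_def)
    ultimately obtain F \<delta> where F: "F \<in> P" "0 < \<delta>" "\<delta> < pi" "tangent (Ds ! i) F"
      "centre F = centre D + of_real (radius D + radius F) * cis (xs ! i + \<delta>)"
      and G: "\<forall>G\<in>P. \<forall>\<epsilon>. 0 < \<epsilon> \<and> \<epsilon> < \<delta> \<longrightarrow>
          centre G \<noteq> centre D + of_real (radius D + radius G) * cis (xs ! i + \<epsilon>)"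
      using step[of "Ds ! i" "cis (xs ! i)"] by (auto simp: touches_def cis_mult)
    have FN: "F \<in> ?N" using memN F by blast
    have cF: "cis (\<phi> F) = cis (xs ! i + \<delta>)"
    proof -
      have "complex_of_real (radius D + radius F) \<noteq> 0" using pos[OF F(1)] of_real_eq_0_iff by (metis less_irrefl)
      then show ?thesis using polar[OF FN] F(5) by (simp del: of_real_add)
    qed
    have bet: "cis z \<noteq> cis (xs ! i + \<epsilon>)" if z: "z \<in> set xs" "0 < \<epsilon>" "\<epsilon> < \<delta>" for z \<epsilon>
    proof -
      obtain G' where G': "G' \<in> ?N" "z = \<phi> G'" using z(1) xs(2) by auto
      then show ?thesis using G polar[OF G'(1)] z(2,3) by (auto simp: tangent_discs_def)
    qed
    have "\<delta> < 2 * pi" using F(3) pi_gt_zero by linarith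
    then have "xs ! (Suc i mod n) = \<phi> F" "gap ((!) xs) n i = \<delta>"
      using sorted_next[OF xs(1) rng i[unfolded n_def] _ cF F(2) _ bet] FN xs(2)
      unfolding n_def by auto
    moreover have "Suc i mod n < n" using n0 by simp
    ultimately have "Ds ! (Suc i mod n) = F"
      using Dsi[of "Suc i mod n"] inj FN by (metis inj_onD)
    then show ?thesis using F \<open>gap ((!) xs) n i = \<delta>\<close> by simp
  qed
  have "cyclic_order (centre D) (map centre Ds)"
    unfolding cyclic_order_def
  proof (intro exI[of _ "(!) xs"] conjI allI impI)
    fix i assume "i < length (map centre Ds)"
    then have i: "i < n" by (simp add: lenDs)
    have "dist (centre D) (centre (Ds ! i)) = radius D + radius (Ds ! i)"
      using Dsi[OF i] by (simp add: tangent_discs_def tangent_def)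
    then show "map centre Ds ! i - centre D = of_real (dist (centre D) (map centre Ds ! i)) * cis (xs ! i)"
      using c[OF i] i lenDs by (metis add_diff_cancel_left' nth_map)
  next
    fix i j assume ij: "i < j \<and> j < length (map centre Ds)"
    then show "xs ! i < xs ! j" using xs(1) by (simp add: sorted_wrt_iff_nth_less lenDs n_def)
    have "xs ! i \<in> {0..<2*pi}" "xs ! j \<in> {0..<2*pi}"
      using rng nth_mem[of i xs] nth_mem[of j xs] ij lenDs by (auto simp: n_def subset_iff)
    then show "xs ! j < xs ! i + 2 * pi" by simp
  qed
  moreover have "surrounds Ds D"
  proof -
    have "angle_at (centre D) (centre (Ds ! i)) (centre (Ds ! (Suc i mod n))) = gap ((!) xs) n i"
      if i: "i < n" for i
    proof -
      have "angle_at (centre D) (centre (Ds ! i)) (centre (Ds ! (Suc i mod n))) =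
        arccos (cos (gap ((!) xs) n i))"
        using c Dsi pos i
        by (intro angle_at_gap[where zs = "\<lambda>i. centre (Ds ! i)" and \<rho> = "\<lambda>i. radius D + radius (Ds ! i)"])
           (auto simp: tangent_discs_def)
      then show ?thesis using nxt[OF i] by (simp add: arccos_cos)
    qed
    then show ?thesis using sum_gap[OF n0, of "(!) xs"] by (simp add: surrounds_def lenDs)
  qed
  ultimately show ?thesis using dist setDs nxt by (intro exI[of _ Ds]) (simp add: lenDs)
qed


section \<open>Hexagonal families of unit discs\<close>

text \<open>The circumradius of an equilateral triangle of side 2, that is, the distance from the
  centre of an inserted disc to the centres of the three discs around it.\<close>

definition tau :: real where "tau = 2 * sqrt 3 / 3"

definition rho :: real where "rho = tau - 1"

lemma tau_sq: "tau\<^sup>2 = 4 / 3"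
  by (simp add: tau_def power_divide power_mult_distrib)

lemma tau_pos: "0 < tau"
  by (simp add: tau_def)

lemma one_plus_rho: "1 + rho = tau" "rho + 1 = tau"
  by (simp_all add: rho_def)

text \<open>The bound \<open>1 / 6\<close> is what the triple angle estimate for
  \<open>alpha\<close> requires; it comes from \<open>7 / 4\<close> as upper bound for
  \<open>sqrt 3\<close>.\<close>

lemma rho_bounds: "0 < rho" "rho < 1 / 6"
proof -
  have "3 / 2 < sqrt 3" by (rule real_less_rsqrt) (simp add: power2_eq_square)
  then show "0 < rho" by (simp add: rho_def tau_def)
  have "sqrt 3 < 7 / 4" by (rule real_less_lsqrt) (simp_all add: power2_eq_square)
  then show "rho < 1 / 6" by (simp add: rho_def tau_def)
qed

abbreviation \<omega> :: complex where "\<omega> \<equiv> cis (pi / 3)"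
abbreviation \<zeta> :: complex where "\<zeta> \<equiv> cis (2 * pi / 3)"

lemma omega_Complex: "\<omega> = Complex (1 / 2) (sqrt 3 / 2)"
  by (simp add: complex_eq_iff cos_60 sin_60)

lemma zeta_eq: "\<zeta> = \<omega>\<^sup>2"
  by (simp add: power2_eq_square cis_mult)

lemma zeta_Complex: "\<zeta> = Complex (- 1 / 2) (sqrt 3 / 2)"
  unfolding zeta_eq by (simp add: omega_Complex power2_eq_square complex_eq_iff)

lemma zeta_square: "\<zeta>\<^sup>2 = Complex (- 1 / 2) (- sqrt 3 / 2)"
  by (simp add: zeta_Complex power2_eq_square complex_eq_iff)

lemma zeta_cube: "\<zeta> ^ 3 = 1"
  by (simp add: zeta_Complex power3_eq_cube complex_eq_iff)

lemma cis_pi_sixth: "cis (pi / 6) = Complex (sqrt 3 / 2) (1 / 2)"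
  by (simp add: complex_eq_iff cos_30 sin_30)

lemma cis_minus_pi_sixth: "cis (- (pi / 6)) = Complex (sqrt 3 / 2) (- 1 / 2)"
  by (simp add: complex_eq_iff cos_30 sin_30)

section \<open>Finding a close direction among three or six equally spaced ones\<close>

lemma norm_diff_sq:
  fixes x y :: complex
  shows "(norm (x - y))\<^sup>2 = (norm x)\<^sup>2 + (norm y)\<^sup>2 - 2 * Re (cnj x * y)"
  unfolding cmod_power2 by (simp add: power2_eq_square algebra_simps)

text \<open>Three directions spaced by 120 degrees leave every direction within 60 degrees of one of
  them.\<close>

lemma three_directions_unit:
  fixes y :: complex
  assumes "norm y = 1"
  shows "\<exists>k<3. 1 / 2 \<le> Re (y * \<zeta> ^ k)"
proof -
  define p q where "p = Re y" and "q = Im y"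
  have pq: "p\<^sup>2 + q\<^sup>2 = 1" using assms cmod_power2[of y] by (simp add: p_def q_def)
  consider "1 / 2 \<le> p" | "p < 1 / 2" by linarith
  then show ?thesis
  proof cases
    case 1
    then show ?thesis by (intro exI[of _ 0]) (simp add: p_def)
  next
    case 2
    have "p\<^sup>2 \<le> 1\<^sup>2" using pq zero_le_power2[of q] by (simp only: one_power2)
    then have p1: "- 1 \<le> p" using abs_le_square_iff[of p 1] by simp
    \<comment> \<open>This product is \<open>3 * q\<^sup>2 - (1 + p)\<^sup>2\<close>. Its sign gives
      \<open>1 + p \<le> sqrt 3 * \<bar>q\<bar>\<close>, which says that one of the two other
      rotates has real part at least \<open>1 / 2\<close>; the sign of \<open>q\<close> tells
      which.\<close>
    have "0 \<le> (1 + p) * (2 - 4 * p)" using p1 2 by (intro mult_nonneg_nonneg) auto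
    also have "\<dots> = 3 * (1 - p\<^sup>2) - (1 + p)\<^sup>2" by (simp add: power2_eq_square algebra_simps)
    also have "1 - p\<^sup>2 = q\<^sup>2" using pq by simp
    finally have "(1 + p)\<^sup>2 \<le> (sqrt 3 * \<bar>q\<bar>)\<^sup>2" by (simp add: power_mult_distrib)
    then have le: "1 + p \<le> sqrt 3 * \<bar>q\<bar>" by (rule power2_le_imp_le) simp
    show ?thesis
    proof (cases "0 \<le> q")
      case True
      then have "1 / 2 \<le> Re (y * \<zeta> ^ 2)"
        using le unfolding zeta_square by (simp add: p_def q_def algebra_simps)
      then show ?thesis by (intro exI[of _ 2]) simp
    next
      case False
      then have "1 / 2 \<le> Re (y * \<zeta> ^ 1)"
        using le unfolding zeta_Complex by (simp add: p_def q_def algebra_simps)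
      then show ?thesis by (intro exI[of _ 1]) simp
    qed
  qed
qed

text \<open>\<open>Re (cnj x * w)\<close> is the inner product of \<open>x\<close> and
  \<open>w\<close>; dividing by \<open>norm x\<close> reduces to the unit circle.\<close>

lemma three_directions:
  fixes x v :: complex
  assumes "norm v = 1"
  shows "\<exists>k<3. norm x / 2 \<le> Re (cnj x * (v * \<zeta> ^ k))"
proof (cases "x = 0")
  case True
  then show ?thesis by (intro exI[of _ 0]) simp
next
  case False
  have "norm (cnj x * v / of_real (norm x)) = 1" using assms False by (simp add: norm_mult norm_divide)
  from three_directions_unit[OF this] obtain k where k: "k < 3"
    "1 / 2 \<le> Re (cnj x * v / of_real (norm x) * \<zeta> ^ k)" by blast
  have e: "cnj x * v / of_real (norm x) * \<zeta> ^ k = (cnj x * (v * \<zeta> ^ k)) / of_real (norm x)"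
    by simp
  have "1 / 2 \<le> Re (cnj x * (v * \<zeta> ^ k)) / norm x"
    using k(2) unfolding e Re_divide_of_real .
  then show ?thesis using k(1) False by (auto simp: field_simps)
qed

lemma Re_of_real_mult: "Re (of_real t * z) = t * Re z"
  by simp

text \<open>The law of cosines for an angle of at most 60 degrees. It serves both to walk along
  small discs towards a unit disc and to find the unit disc of a pocket nearest to a given
  point.\<close>

lemma three_directions_dist:
  fixes x v :: complex
  assumes "norm v = 1" "0 \<le> t"
  shows "\<exists>k<3. (norm (x - of_real t * (v * \<zeta> ^ k)))\<^sup>2 \<le> (norm x)\<^sup>2 + t\<^sup>2 - t * norm x"
proof -
  obtain k where k: "k < 3" "norm x / 2 \<le> Re (cnj x * (v * \<zeta> ^ k))"
    using three_directions[OF assms(1)] by blast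
  have n: "norm (of_real t * (v * \<zeta> ^ k)) = t"
    using assms by (simp add: norm_mult norm_power)
  have "cnj x * (of_real t * (v * \<zeta> ^ k)) = of_real t * (cnj x * (v * \<zeta> ^ k))"
    by (simp only: mult_ac)
  then have "Re (cnj x * (of_real t * (v * \<zeta> ^ k))) = t * Re (cnj x * (v * \<zeta> ^ k))"
    by (simp only: Re_of_real_mult)
  moreover have "t * (norm x / 2) \<le> t * Re (cnj x * (v * \<zeta> ^ k))"
    using k(2) assms(2) by (rule mult_left_mono)
  ultimately show ?thesis
    using k(1) norm_diff_sq[of x "of_real t * (v * \<zeta> ^ k)"] unfolding n
    by (intro exI[of _ k]) linarith
qed

text \<open>Some rotate of \<open>v\<close> is within 30 degrees of \<open>x\<close>. The cruder
  bound stated here is already what makes two unit discs in these directions overlap.\<close>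

lemma six_directions:
  fixes x v :: complex
  assumes "norm v = 1" "norm x = 1"
  shows "\<exists>k<6. norm (x - v * \<omega> ^ k) < 1"
proof -
  define y where "y = cnj x * v"
  define p q where "p = Re y" and "q = Im y"
  have y1: "norm y = 1" using assms by (simp add: y_def norm_mult)
  then have pq: "p\<^sup>2 + q\<^sup>2 = 1" using cmod_power2[of y] by (simp add: p_def q_def)
  have "\<exists>k<6. 1 / 2 < Re (y * \<omega> ^ k)"
  proof -
    have w2: "\<omega> ^ 2 = Complex (- 1 / 2) (sqrt 3 / 2)" using zeta_eq zeta_Complex by simp
    have w3: "\<omega> ^ 3 = - 1" by (simp add: omega_Complex power3_eq_cube complex_eq_iff)
    have "\<omega> ^ (3 + 1) = \<omega> ^ 3 * \<omega> ^ 1" "\<omega> ^ (3 + 2) = \<omega> ^ 3 * \<omega> ^ 2" by (rule power_add)+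
    then have w4: "\<omega> ^ 4 = Complex (- 1 / 2) (- sqrt 3 / 2)"
      and w5: "\<omega> ^ 5 = Complex (1 / 2) (- sqrt 3 / 2)"
      unfolding w3 w2 by (simp_all add: omega_Complex complex_eq_iff)
    consider "1 / 2 < p" | "p < - 1 / 2" | "\<bar>p\<bar> \<le> 1 / 2" by linarith
    then show ?thesis
    proof cases
      case 1
      then show ?thesis by (intro exI[of _ 0]) (simp add: p_def)
    next
      case 2
      then have "1 / 2 < Re (y * \<omega> ^ 3)" unfolding w3 by (simp add: p_def)
      then show ?thesis by (intro exI[of _ 3]) simp
    next
      case 3
      then have "p\<^sup>2 \<le> (1 / 2)\<^sup>2" using abs_le_square_iff[of p "1 / 2"] by simp
      then have "(sqrt 3 / 2)\<^sup>2 \<le> \<bar>q\<bar>\<^sup>2" using pq by (simp add: power_divide)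
      then have "sqrt 3 / 2 \<le> \<bar>q\<bar>" by (rule power2_le_imp_le) simp
      then have "sqrt 3 / 2 * (sqrt 3 / 2) \<le> sqrt 3 / 2 * \<bar>q\<bar>" by (rule mult_left_mono) simp
      then have q: "3 / 4 \<le> sqrt 3 / 2 * \<bar>q\<bar>" by simp
      \<comment> \<open>The signs of \<open>p\<close> and \<open>q\<close> select the rotate whose
        real part is \<open>\<bar>p\<bar> / 2 + sqrt 3 / 2 * \<bar>q\<bar>\<close>, hence at least
        \<open>3 / 4\<close>.\<close>
      consider "0 \<le> p" "0 \<le> q" | "0 \<le> p" "q < 0" | "p < 0" "0 \<le> q" | "p < 0" "q < 0" by linarith
      then show ?thesis
      proof cases
        case 1
        then have "1 / 2 < Re (y * \<omega> ^ 5)" using q unfolding w5 by (simp add: p_def q_def algebra_simps)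
        then show ?thesis by (intro exI[of _ 5]) simp
      next
        case 2
        then have "1 / 2 < Re (y * \<omega> ^ 1)" using q unfolding omega_Complex by (simp add: p_def q_def algebra_simps)
        then show ?thesis by (intro exI[of _ 1]) simp
      next
        case 3
        then have "1 / 2 < Re (y * \<omega> ^ 4)" using q unfolding w4 by (simp add: p_def q_def algebra_simps)
        then show ?thesis by (intro exI[of _ 4]) simp
      next
        case 4
        then have "1 / 2 < Re (y * \<omega> ^ 2)" using q unfolding w2 by (simp add: p_def q_def algebra_simps)
        then show ?thesis by (intro exI[of _ 2]) simp
      qed
    qed
  qed
  then obtain k where k: "k < 6" "1 / 2 < Re (y * \<omega> ^ k)" by blast
  have n: "norm (v * \<omega> ^ k) = 1" using assms by (simp add: norm_mult norm_power)
  have e: "cnj x * (v * \<omega> ^ k) = y * \<omega> ^ k" by (simp add: y_def)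
  have "(norm (x - v * \<omega> ^ k))\<^sup>2 < 1\<^sup>2"
    using k(2) unfolding norm_diff_sq[of x "v * \<omega> ^ k"] n e assms by simp
  then have "norm (x - v * \<omega> ^ k) < 1" by (rule power2_less_imp_less) simp
  then show ?thesis using k(1) by blast
qed

lemma dist_touches_sq:
  assumes "touches D v E" "touches D w F"
  shows "(dist (centre E) (centre F))\<^sup>2 = (radius D + radius E)\<^sup>2 + (radius D + radius F)\<^sup>2
    - 2 * (radius D + radius E) * (radius D + radius F) * Re (cnj v * w)"
proof -
  define a b where "a = radius D + radius E" and "b = radius D + radius F"
  have v: "norm v = 1" "norm w = 1" using assms by (auto simp: touches_def)
  have "dist (centre E) (centre F) = norm (of_real a * v - of_real b * w)"
    using assms by (simp add: touches_def dist_norm a_def b_def)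
  then have "(dist (centre E) (centre F))\<^sup>2 =
      (norm (of_real a * v))\<^sup>2 + (norm (of_real b * w))\<^sup>2 - 2 * Re (cnj (of_real a * v) * (of_real b * w))"
    using norm_diff_sq by simp
  also have "cnj (of_real a * v) * (of_real b * w) = of_real (a * b) * (cnj v * w)" by simp
  finally show ?thesis using v by (simp add: norm_mult a_def b_def power_mult_distrib del: of_real_mult of_real_add)
qed

lemma cnj_mult_cis: "norm v = 1 \<Longrightarrow> Re (cnj v * (v * cis \<epsilon>)) = cos \<epsilon>"
proof -
  assume "norm v = 1"
  then have "cnj v * v = 1" by (metis complex_norm_square mult.commute of_real_1 one_power2)
  then have "cnj v * (v * cis \<epsilon>) = cis \<epsilon>" by (metis mult.assoc mult_1)
  then show ?thesis by (simp only: cis.sel)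
qed

section \<open>Unit discs at steps of 60 degrees\<close>

definition unit_packing :: "disc set \<Rightarrow> bool" where
  "unit_packing T \<longleftrightarrow> is_packing T \<and> (\<forall>D\<in>T. radius D = 1)"

text \<open>A turn below 60 degrees brings the centres closer than 2, so the discs coincide; then
  \<open>cis \<epsilon> = 1\<close>, which a positive turn below 60 degrees does not
  satisfy.\<close>

lemma unit_neighbours_apart:
  assumes "unit_packing T" "D \<in> T" "E \<in> T" "F \<in> T" "touches D v E" "touches D (v * cis \<epsilon>) F"
    "0 < \<epsilon>" "\<epsilon> < pi / 3"
  shows False
proof -
  have r: "radius D = 1" "radius E = 1" "radius F = 1" using assms by (auto simp: unit_packing_def)
  have v: "norm v = 1" using assms by (simp add: touches_def)
  have "cos (pi / 3) < cos \<epsilon>" by (rule cos_monotone_0_pi) (use assms in auto)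
  then have "(dist (centre E) (centre F))\<^sup>2 < 2\<^sup>2"
    using dist_touches_sq[OF assms(5,6)] by (simp add: r cnj_mult_cis[OF v] cos_60 del: times_complex.simps)
  then have "dist (centre E) (centre F) < 2" by (rule power2_less_imp_less) simp
  then have "E = F" using packing_eqI[of T E F] assms r by (simp add: unit_packing_def)
  then have "v * cis \<epsilon> = v * 1" using touches_unique[OF assms(6), of v] assms(5) r by simp
  then have "cis \<epsilon> = 1" using v by force
  then have "cos \<epsilon> = cos 0" by (simp add: complex_eq_iff)
  then show False using \<open>cos (pi / 3) < cos \<epsilon>\<close> cos_monotone_0_pi[of 0 \<epsilon>] assms by simp
qed

text \<open>A local working form of \<open>triangular_lattice_packing\<close>: closure of the
  neighbour directions under turns of 60 degrees replaces the count of six. The two notions are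
  shown to agree below.\<close>

definition hexagonal :: "disc set \<Rightarrow> bool" where
  "hexagonal T \<longleftrightarrow> unit_packing T \<and> T \<noteq> {} \<and> (\<forall>D\<in>T. \<exists>E\<in>T. tangent D E) \<and>
     (\<forall>D\<in>T. \<forall>E\<in>T. \<forall>v. touches D v E \<longrightarrow> (\<exists>F\<in>T. touches D (v * \<omega>) F))"

lemma hexagonal_rotate:
  assumes "hexagonal T" "D \<in> T" "E \<in> T" "touches D v E"
  shows "\<exists>F\<in>T. touches D (v * \<omega> ^ k) F"
proof (induction k)
  case (Suc k)
  then obtain F where "F \<in> T" "touches D (v * \<omega> ^ k) F" by blast
  then obtain G where "G \<in> T" "touches D (v * \<omega> ^ k * \<omega>) G"
    using assms unfolding hexagonal_def by meson
  then show ?case by (auto simp: mult_ac)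
qed (use assms in auto)

text \<open>Some disc in a direction \<open>v * \<omega> ^ k\<close> lies so close to
  \<open>F\<close> that the two overlap, hence it is \<open>F\<close>.\<close>

lemma hexagonal_direction:
  assumes "hexagonal T" "D \<in> T" "E \<in> T" "touches D v E" "F \<in> T" "touches D w F"
  shows "\<exists>k<6. w = v * \<omega> ^ k"
proof -
  have T: "unit_packing T" using assms by (simp add: hexagonal_def)
  have n: "norm v = 1" "norm w = 1" using assms by (auto simp: touches_def)
  obtain k where k: "k < 6" "norm (w - v * \<omega> ^ k) < 1" using six_directions[OF n] by blast
  obtain G where G: "G \<in> T" "touches D (v * \<omega> ^ k) G" using hexagonal_rotate assms(1-4) by blast
  have r: "radius D = 1" "radius F = 1" "radius G = 1"
    using T assms G by (auto simp: unit_packing_def)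
  have "centre F - centre G = 2 * (w - v * \<omega> ^ k)"
    using assms(6) G(2) r by (simp add: touches_def algebra_simps)
  then have "dist (centre F) (centre G) = 2 * norm (w - v * \<omega> ^ k)"
    by (simp only: dist_norm norm_mult norm_numeral)
  then have "dist (centre F) (centre G) < 2" using k(2) by simp
  then have "F = G" using packing_eqI[of T F G] T assms(5) G r by (simp add: unit_packing_def)
  then have "w = v * \<omega> ^ k" using touches_unique[OF assms(6), of "v * \<omega> ^ k"] G(2) r by simp
  then show ?thesis using k(1) by blast
qed

lemma cis_power_inj: "j < 6 \<Longrightarrow> k < 6 \<Longrightarrow> \<omega> ^ j = \<omega> ^ k \<Longrightarrow> j = k"
proof (rule ccontr)
  assume a: "j < 6" "k < 6" "\<omega> ^ j = \<omega> ^ k" "j \<noteq> k"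
  have "cis (j * (pi / 3)) = cis (k * (pi / 3))" using a(3) unfolding Complex.DeMoivre .
  moreover have "\<bar>j * (pi / 3) - k * (pi / 3)\<bar> < 2 * pi"
  proof -
    have "\<bar>real j - real k\<bar> < 6" using a by linarith
    then have "\<bar>real j - real k\<bar> * (pi / 3) < 6 * (pi / 3)" by (intro mult_strict_right_mono) auto
    moreover have "\<bar>j * (pi / 3) - k * (pi / 3)\<bar> = \<bar>real j - real k\<bar> * (pi / 3)"
      by (simp only: left_diff_distrib[symmetric] abs_mult) simp
    ultimately show ?thesis by linarith
  qed
  ultimately have "j * (pi / 3) = k * (pi / 3)"
    using cis_eqD[of "j * (pi / 3)" "k * (pi / 3)"] pi_gt_zero by linarith
  then show False using a(4) by simp
qed

lemma hexagonal_card: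
  assumes "hexagonal T" "D \<in> T"
  shows "card (tangent_discs T D) = 6"
proof -
  have T: "unit_packing T" using assms by (simp add: hexagonal_def)
  then have P: "is_packing T" by (simp add: unit_packing_def)
  obtain E where "E \<in> T" "tangent D E" using assms unfolding hexagonal_def by blast
  then obtain v where v: "touches D v E" using tangent_touches packing_radius_pos[OF P] assms by blast
  obtain f where f: "\<And>k. f k \<in> T \<and> touches D (v * \<omega> ^ k) (f k)"
    using hexagonal_rotate[OF assms \<open>E \<in> T\<close> v] by metis
  have v1: "v \<noteq> 0" using v by (auto simp: touches_def)
  have "inj_on f {..<6}"
  proof (rule inj_onI)
    fix j k assume jk: "j \<in> {..<6::nat}" "k \<in> {..<6}" "f j = f k"
    then have "v * \<omega> ^ j = v * \<omega> ^ k"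
      using f[of j] f[of k] touches_unique packing_radius_pos[OF P] assms(2) by metis
    then show "j = k" using v1 cis_power_inj jk by simp
  qed
  moreover have "f ` {..<6} = tangent_discs T D"
  proof
    show "f ` {..<6} \<subseteq> tangent_discs T D"
      using f touches_tangent packing_radius_pos[OF P] assms(2) unfolding tangent_discs_def by blast
    show "tangent_discs T D \<subseteq> f ` {..<6}"
    proof
      fix F assume "F \<in> tangent_discs T D"
      then have F: "F \<in> T" "tangent D F" by (auto simp: tangent_discs_def)
      then obtain w where w: "touches D w F" using tangent_touches packing_radius_pos[OF P] assms by blast
      obtain k where k: "k < 6" "w = v * \<omega> ^ k" using hexagonal_direction[OF assms \<open>E \<in> T\<close> v F(1) w] by blast
      then have "F = f k" using touches_inj[OF P F(1), of "f k" D w] w f by auto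
      then show "F \<in> f ` {..<6}" using k by simp
    qed
  qed
  ultimately show ?thesis using card_image by fastforce
qed

lemma hexagonal_triangular: "hexagonal T \<Longrightarrow> triangular_lattice_packing T"
  using hexagonal_card by (auto simp: triangular_lattice_packing_def hexagonal_def unit_packing_def)


text \<open>Six directions pairwise at least 60 degrees apart use up the whole circle, so no gap can
  be larger.\<close>

lemma triangular_next:
  assumes T: "triangular_lattice_packing T" and D: "D \<in> T" and E: "E \<in> T" "touches D v E"
  shows "\<exists>F\<in>T. touches D (v * \<omega>) F"
proof -
  have P: "is_packing T" and U: "unit_packing T"
    using T by (auto simp: triangular_lattice_packing_def unit_packing_def)
  let ?N = "tangent_discs T D"
  have card: "card ?N = 6" using T D by (simp add: triangular_lattice_packing_def)
  have v: "norm v = 1" "v \<noteq> 0" using E by (auto simp: touches_def)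
  have "v * cnj v = 1" using v(1) complex_norm_square[of v] by simp
  then have vv: "v * (cnj v * w) = w" for w by (simp only: mult.assoc[symmetric] mult_1)
  define dir where "dir F = (SOME w. touches D w F)" for F
  have dir: "touches D (dir F) F" if "F \<in> ?N" for F
  proof -
    have "F \<in> T" "tangent D F" using that by (auto simp: tangent_discs_def)
    then have "\<exists>w. touches D w F" using tangent_touches packing_radius_pos[OF P] D by blast
    then show ?thesis unfolding dir_def by (rule someI_ex)
  qed
  \<comment> \<open>Multiplying by \<open>cnj v\<close> divides by \<open>v\<close>, so angles are
    measured from the direction of \<open>E\<close>.\<close>
  define \<phi> where "\<phi> F = Arg2pi (cnj v * dir F)" for F
  have polar: "touches D (v * cis (\<phi> F)) F" if "F \<in> ?N" for F
  proof -
    have "norm (cnj v * dir F) = 1" using dir[OF that] v by (simp add: touches_def norm_mult)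
    then have "cis (\<phi> F) = cnj v * dir F" using Arg2pi_polar[of "cnj v * dir F"] by (simp add: \<phi>_def)
    then show ?thesis using dir[OF that] by (simp only: vv)
  qed
  have rng: "0 \<le> \<phi> F" "\<phi> F < 2 * pi" for F using Arg2pi_range by (auto simp: \<phi>_def)
  have apart: "pi / 3 \<le> \<phi> G - \<phi> F" if "F \<in> ?N" "G \<in> ?N" "\<phi> F < \<phi> G" for F G
  proof (rule ccontr)
    assume "\<not> ?thesis"
    moreover have "touches D (v * cis (\<phi> F) * cis (\<phi> G - \<phi> F)) G"
      using polar[OF that(2)] by (simp add: mult.assoc cis_mult)
    ultimately show False
      using unit_neighbours_apart[OF U D _ _ polar[OF that(1)], of G "\<phi> G - \<phi> F"] that
      by (auto simp: tangent_discs_def)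
  qed
  have inj: "inj_on \<phi> ?N"
  proof (rule inj_onI)
    fix F G assume "F \<in> ?N" "G \<in> ?N" "\<phi> F = \<phi> G"
    then show "F = G" using polar[of F] polar[of G] touches_inj[OF P, of F G]
      by (auto simp: tangent_discs_def)
  qed
  \<comment> \<open>Each of the six half-open sectors of angle \<open>\<pi>/3\<close> starting at \<open>E\<close> contains exactly one neighbour.\<close>
  define \<kappa> where "\<kappa> F = nat \<lfloor>\<phi> F / (pi / 3)\<rfloor>" for F
  have \<kappa>: "real (\<kappa> F) * (pi / 3) \<le> \<phi> F" "\<phi> F < (real (\<kappa> F) + 1) * (pi / 3)" for F
  proof -
    have "real (\<kappa> F) = of_int \<lfloor>\<phi> F / (pi / 3)\<rfloor>" using rng(1)[of F] by (simp add: \<kappa>_def)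
    then have "real (\<kappa> F) \<le> \<phi> F / (pi / 3)" "\<phi> F / (pi / 3) < real (\<kappa> F) + 1" by linarith+
    moreover have "0 < pi / 3" by simp
    ultimately show "real (\<kappa> F) * (pi / 3) \<le> \<phi> F" "\<phi> F < (real (\<kappa> F) + 1) * (pi / 3)"
      using pos_le_divide_eq pos_divide_less_eq by blast+
  qed
  have \<kappa>6: "\<kappa> F < 6" for F
  proof -
    have "real (\<kappa> F) * (pi / 3) < 6 * (pi / 3)" using \<kappa>(1)[of F] rng(2)[of F] by linarith
    then have "real (\<kappa> F) < 6" by (rule mult_right_less_imp_less) simp
    then show ?thesis by simp
  qed
  have inj\<kappa>: "inj_on \<kappa> ?N"
  proof (rule inj_onI)
    have "\<not> \<phi> F < \<phi> G" if "F \<in> ?N" "G \<in> ?N" "\<kappa> F = \<kappa> G" for F G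
      using apart[OF that(1,2)] \<kappa>(1)[of F] \<kappa>(2)[of G] that(3) by (auto simp: algebra_simps)
    then show "F = G" if "F \<in> ?N" "G \<in> ?N" "\<kappa> F = \<kappa> G" for F G
      using inj that by (metis inj_onD linorder_neqE_linordered_idom)
  qed
  have "\<kappa> ` ?N = {..<6}"
    using \<kappa>6 card card_image[OF inj\<kappa>] by (intro card_subset_eq) auto
  then have "\<exists>F. F \<in> ?N \<and> \<kappa> F = k" if "k < 6" for k
    using that by (metis (no_types, lifting) imageE lessThan_iff)
  then obtain f where f: "\<And>k. k < 6 \<Longrightarrow> f k \<in> ?N \<and> \<kappa> (f k) = k" by metis
  have EN: "E \<in> ?N" using E touches_tangent packing_radius_pos[OF P] D by (auto simp: tangent_discs_def)
  have "\<phi> E = 0"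
  proof -
    have "v * cis (\<phi> E) = v" using touches_unique[OF polar[OF EN] E(2)] packing_radius_pos[OF P] D E(1) by blast
    then have "cis (\<phi> E) = cis 0" using v by simp
    then show ?thesis using cis_eqD[of "\<phi> E" 0] rng[of E] by simp
  qed
  have step: "\<phi> (f k) \<le> \<phi> (f (Suc k)) - pi / 3" if "Suc k < 6" for k
  proof -
    have k: "f k \<in> ?N" "\<kappa> (f k) = k" "f (Suc k) \<in> ?N" "\<kappa> (f (Suc k)) = Suc k"
      using f[of k] f[of "Suc k"] that by auto
    have "\<phi> (f k) < (real k + 1) * (pi / 3)" "(real k + 1) * (pi / 3) \<le> \<phi> (f (Suc k))"
      using \<kappa>(2)[of "f k"] \<kappa>(1)[of "f (Suc k)"] k(2,4) by (simp_all add: add.commute)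
    then have "\<phi> (f k) < \<phi> (f (Suc k))" by linarith
    then show ?thesis using apart[OF k(1,3)] by linarith
  qed
  \<comment> \<open>The separation also holds across the wrap from \<open>f 5\<close> back to
    \<open>E\<close>. Going back four gaps of at least \<open>pi / 3\<close> leaves
    \<open>f 1\<close> at most \<open>pi / 3\<close>, which is where its sector begins.\<close>
  have "\<phi> (f 5) \<le> 5 * (pi / 3)"
  proof (rule ccontr)
    assume a: "\<not> ?thesis"
    have F: "f 5 \<in> T" "touches D (v * cis (\<phi> (f 5))) (f 5)" using f[of 5] polar by (auto simp: tangent_discs_def)
    have "touches D (v * cis (\<phi> (f 5)) * cis (2 * pi - \<phi> (f 5))) E"
      using E(2) by (simp add: mult.assoc cis_mult)
    moreover have "0 < 2 * pi - \<phi> (f 5)" "2 * pi - \<phi> (f 5) < pi / 3"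
      using a rng(2)[of "f 5"] by linarith+
    ultimately show False using unit_neighbours_apart[OF U D F(1) E(1) F(2)] by blast
  qed
  moreover have "\<phi> (f 4) \<le> \<phi> (f 5) - pi / 3" "\<phi> (f 3) \<le> \<phi> (f 4) - pi / 3"
    "\<phi> (f 2) \<le> \<phi> (f 3) - pi / 3" "\<phi> (f 1) \<le> \<phi> (f 2) - pi / 3"
    using step[of 4] step[of 3] step[of 2] step[of 1] by (simp_all add: numeral_eq_Suc)
  ultimately have "\<phi> (f 1) \<le> pi / 3" by linarith
  moreover have "pi / 3 \<le> \<phi> (f 1)" using \<kappa>(1)[of "f 1"] f[of 1] by simp
  ultimately have "\<phi> (f 1) = pi / 3" by linarith
  moreover have "f 1 \<in> ?N" using f[of 1] by simp
  ultimately show ?thesis using polar[of "f 1"] unfolding tangent_discs_def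
    by (metis (no_types, lifting) mem_Collect_eq)
qed

lemma triangular_hexagonal:
  assumes "triangular_lattice_packing T"
  shows "hexagonal T"
proof -
  have "\<exists>E\<in>T. tangent D E" if "D \<in> T" for D
  proof -
    have "tangent_discs T D \<noteq> {}" using assms that by (auto simp: triangular_lattice_packing_def)
    then show ?thesis by (auto simp: tangent_discs_def)
  qed
  then show ?thesis
    using assms triangular_next[OF assms]
    unfolding hexagonal_def unit_packing_def triangular_lattice_packing_def by blast
qed

section \<open>Small discs between three unit discs\<close>

text \<open>A formulation free of topology, shared by both halves of the theorem. All exponents are
  allowed, so that rotating needs no reduction modulo 3; since \<open>\<zeta> ^ 3 = 1\<close> only
  three directions occur.\<close>

definition pocket :: "disc set \<Rightarrow> disc \<Rightarrow> bool" where
  "pocket T G \<longleftrightarrow> radius G = rho \<and> (\<exists>v. norm v = 1 \<and> (\<forall>k. \<exists>A\<in>T. touches G (v * \<zeta> ^ k) A))"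

lemma radius_sum: "radius G = rho \<Longrightarrow> radius A = 1 \<Longrightarrow> radius G + radius A = tau"
  by (simp add: rho_def)

text \<open>Seen from \<open>G\<close>, some corner \<open>A\<close> is within 60 degrees of
  \<open>E\<close>, and for distances below \<open>2 * tau\<close> this forces \<open>E\<close> to
  overlap \<open>A\<close>. The radius \<open>2 * tau\<close> is the distance from the centroid to
  the mirror image of a vertex in the opposite side, where the next lattice centres lie.\<close>

lemma pocket_nearest:
  assumes T: "unit_packing T" and G: "radius G = rho" "norm v = 1"
    and A: "\<And>k. \<exists>A\<in>T. touches G (v * \<zeta> ^ k) A"
    and E: "E \<in> T" "dist (centre G) (centre E) < 2 * tau"
  shows "\<exists>k<3. touches G (v * \<zeta> ^ k) E"
proof -
  define x d where "x = centre E - centre G" and "d = norm x"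
  have d: "d < 2 * tau" "0 \<le> d" using E by (simp_all add: d_def x_def dist_norm norm_minus_commute)
  obtain k where k: "k < 3" "(norm (x - of_real tau * (v * \<zeta> ^ k)))\<^sup>2 \<le> (norm x)\<^sup>2 + tau\<^sup>2 - tau * norm x"
    using three_directions_dist[OF G(2)] tau_pos less_imp_le by blast
  obtain A where A: "A \<in> T" "touches G (v * \<zeta> ^ k) A" using A by blast
  have r: "radius A = 1" "radius E = 1" using T A E by (auto simp: unit_packing_def)
  have "centre A = centre G + of_real tau * (v * \<zeta> ^ k)"
    using A(2) radius_sum[OF G(1) r(1)] by (simp only: touches_def)
  then have "dist (centre E) (centre A) = norm (x - of_real tau * (v * \<zeta> ^ k))"
    by (simp add: x_def dist_norm algebra_simps)
  then have "(dist (centre E) (centre A))\<^sup>2 \<le> d\<^sup>2 + tau\<^sup>2 - tau * d"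
    using k(2) by (simp only: d_def)
  \<comment> \<open>The factorisation isolates the critical distance \<open>2 * tau\<close>; the
    remainder \<open>3 * tau\<^sup>2 = 4\<close> is the squared distance of tangent unit
    discs.\<close>
  also have "\<dots> = (d - 2 * tau) * (d + tau) + 3 * tau\<^sup>2" by (simp add: power2_eq_square algebra_simps)
  also have "\<dots> < 3 * tau\<^sup>2" using d tau_pos by (simp add: mult_neg_pos add_nonneg_pos)
  also have "\<dots> = 2\<^sup>2" unfolding tau_sq by simp
  finally have "dist (centre E) (centre A) < 2" by (rule power2_less_imp_less) simp
  then have "E = A" using packing_eqI[of T E A] T E(1) A(1) r by (simp add: unit_packing_def)
  then show ?thesis using A k by blast
qed

text \<open>Some corner of \<open>G'\<close> points away from \<open>G\<close>, at 120 degrees or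
  more, so it is farther than \<open>tau\<close> from \<open>centre G\<close>. It is nevertheless
  nearer than \<open>2 * tau\<close>, hence a corner of \<open>G\<close> and at distance exactly
  \<open>tau\<close>.\<close>

lemma pockets_apart:
  assumes T: "unit_packing T" and "pocket T G" "pocket T G'" "dist (centre G) (centre G') < tau"
  shows "centre G = centre G'"
proof (rule ccontr)
  assume ne: "centre G \<noteq> centre G'"
  obtain v where v: "norm v = 1" "\<And>k. \<exists>A\<in>T. touches G (v * \<zeta> ^ k) A" and G: "radius G = rho"
    using assms(2) unfolding pocket_def by blast
  obtain w where w: "norm w = 1" "\<And>k. \<exists>A\<in>T. touches G' (w * \<zeta> ^ k) A" and G': "radius G' = rho"
    using assms(3) unfolding pocket_def by blast
  define x where "x = centre G - centre G'"
  \<comment> \<open>The minus sign selects a corner on the far side of \<open>G'\<close> instead of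
    the near one.\<close>
  have "norm (- w) = 1" using w by simp
  from three_directions[OF this, of x] obtain k where k: "norm x / 2 \<le> Re (cnj x * (- w * \<zeta> ^ k))" by blast
  obtain A where A: "A \<in> T" "touches G' (w * \<zeta> ^ k) A" using w by blast
  have r: "radius A = 1" using T A by (auto simp: unit_packing_def)
  have cA: "centre A - centre G' = of_real tau * (w * \<zeta> ^ k)"
    using A(2) radius_sum[OF G' r] unfolding touches_def by (metis add_diff_cancel_left')
  note t = tau_pos
  have n: "norm (of_real tau * (w * \<zeta> ^ k)) = tau"
    using w t by (simp add: norm_mult norm_power)
  have "dist (centre G) (centre A) \<le> dist (centre G) (centre G') + dist (centre G') (centre A)"
    by (rule dist_triangle)
  moreover have "dist (centre G') (centre A) = tau"
    using cA n by (simp only: dist_norm norm_minus_commute)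
  ultimately have "dist (centre G) (centre A) < 2 * tau" using assms(4) by simp
  from pocket_nearest[OF T G v(1,2) A(1) this] obtain j where "touches G (v * \<zeta> ^ j) A" by blast
  then have dA: "dist (centre G) (centre A) = tau"
    using touches_tangent radius_sum[OF G r] rho_bounds r G by (metis tangent_def zero_less_one)
  have "dist (centre G) (centre A) = norm (x - of_real tau * (w * \<zeta> ^ k))"
    unfolding cA[symmetric] by (simp add: x_def dist_norm)
  then have "tau\<^sup>2 = (norm x)\<^sup>2 + tau\<^sup>2 - 2 * Re (cnj x * (of_real tau * (w * \<zeta> ^ k)))"
    using norm_diff_sq[of x "of_real tau * (w * \<zeta> ^ k)"] dA n by (simp del: times_complex.simps)
  moreover have "Re (cnj x * (of_real tau * (w * \<zeta> ^ k))) = - (tau * Re (cnj x * (- w * \<zeta> ^ k)))"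
  proof -
    have "cnj x * (of_real tau * (w * \<zeta> ^ k)) = of_real (- tau) * (cnj x * (- w * \<zeta> ^ k))" by simp
    also have "Re \<dots> = - tau * Re (cnj x * (- w * \<zeta> ^ k))"
      by (rule Re_of_real_mult)
    finally show ?thesis by simp
  qed
  moreover have "tau * (norm x / 2) \<le> tau * Re (cnj x * (- w * \<zeta> ^ k))"
    using k t by (intro mult_left_mono) auto
  ultimately have "(norm x)\<^sup>2 + tau * norm x \<le> 0" by linarith
  moreover have "0 < (norm x)\<^sup>2 + tau * norm x" using ne t by (intro add_pos_pos) (auto simp: x_def)
  ultimately show False by simp
qed


section \<open>Compact packings arise from filled lattices\<close>

text \<open>The angle at a small disc between a unit and a small neighbour.\<close>

definition alpha :: real where "alpha = arccos (rho / tau)"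

lemma angle_unit_unit:
  assumes "tangent D E" "tangent D F" "tangent E F" "radius D = 1" "radius E = 1" "radius F = 1"
  shows "angle_at (centre D) (centre E) (centre F) = pi / 3"
  unfolding angle_at_tangent[OF assms(1-3), unfolded assms(4-), OF zero_less_one zero_less_one zero_less_one]
  using arccos_cos[of "pi / 3"] by (simp add: cos_60)

lemma tau_inverse: "1 / tau = sqrt 3 / 2"
  by (simp add: tau_def field_simps)

text \<open>A base angle of the isosceles triangle with base 2 and legs \<open>tau\<close>: its
  cosine is half the base over a leg.\<close>

lemma angle_unit_mixed:
  assumes "tangent D E" "tangent D F" "tangent E F" "radius D = 1"
    "radius E = 1 \<and> radius F = rho \<or> radius E = rho \<and> radius F = 1"
  shows "angle_at (centre D) (centre E) (centre F) = pi / 6"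
proof -
  have "angle_at (centre D) (centre E) (centre F) = arccos (1 / tau)"
    using assms(5)
  proof
    assume r: "radius E = 1 \<and> radius F = rho"
    have "angle_at (centre D) (centre E) (centre F) = arccos (((1+1)\<^sup>2 + tau\<^sup>2 - tau\<^sup>2) / (2 * (1+1) * tau))"
      using angle_at_tangent[OF assms(1-3)] r assms(4) rho_bounds(1) by (simp add: one_plus_rho)
    then show ?thesis by simp
  next
    assume r: "radius E = rho \<and> radius F = 1"
    have "angle_at (centre D) (centre E) (centre F) = arccos ((tau\<^sup>2 + (1+1)\<^sup>2 - tau\<^sup>2) / (2 * tau * (1+1)))"
      using angle_at_tangent[OF assms(1-3)] r assms(4) rho_bounds(1) by (simp add: one_plus_rho)
    then show ?thesis by simp
  qed
  then show ?thesis using arccos_cos[of "pi / 6"] by (simp add: tau_inverse cos_30)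
qed

lemma angle_small_units:
  assumes "tangent D E" "tangent D F" "tangent E F" "radius D = rho" "radius E = 1" "radius F = 1"
  shows "angle_at (centre D) (centre E) (centre F) = 2 * pi / 3"
proof -
  have "angle_at (centre D) (centre E) (centre F) = arccos ((tau\<^sup>2 + tau\<^sup>2 - (1+1)\<^sup>2) / (2 * tau * tau))"
    using angle_at_tangent[OF assms(1-3)] assms(4-) rho_bounds(1) by (simp add: one_plus_rho)
  also have "2 * tau * tau = 2 * tau\<^sup>2" by (simp add: power2_eq_square)
  finally show ?thesis using arccos_cos[of "2 * pi / 3"] by (simp add: tau_sq cos_120)
qed

lemma angle_small_smalls:
  assumes "tangent D E" "tangent D F" "tangent E F" "radius D = rho" "radius E = rho" "radius F = rho"
  shows "angle_at (centre D) (centre E) (centre F) = pi / 3"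
proof -
  have "angle_at (centre D) (centre E) (centre F) =
      arccos (((rho+rho)\<^sup>2 + (rho+rho)\<^sup>2 - (rho+rho)\<^sup>2) / (2 * (rho+rho) * (rho+rho)))"
    using angle_at_tangent[OF assms(1-3)] assms(4-) rho_bounds(1) by simp
  also have "((rho+rho)\<^sup>2 + (rho+rho)\<^sup>2 - (rho+rho)\<^sup>2) / (2 * (rho+rho) * (rho+rho)) = 1 / 2"
    using rho_bounds(1) by (simp add: power2_eq_square)
  finally show ?thesis using arccos_cos[of "pi / 3"] by (simp add: cos_60)
qed

lemma angle_small_mixed:
  assumes "tangent D E" "tangent D F" "tangent E F" "radius D = rho"
    "radius E = 1 \<and> radius F = rho \<or> radius E = rho \<and> radius F = 1"
  shows "angle_at (centre D) (centre E) (centre F) = alpha"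
  using assms(5)
proof
  assume r: "radius E = 1 \<and> radius F = rho"
  have "angle_at (centre D) (centre E) (centre F) =
      arccos ((tau\<^sup>2 + (rho+rho)\<^sup>2 - tau\<^sup>2) / (2 * tau * (rho+rho)))"
    using angle_at_tangent[OF assms(1-3)] r assms(4) rho_bounds(1) by (simp add: one_plus_rho)
  also have "(tau\<^sup>2 + (rho+rho)\<^sup>2 - tau\<^sup>2) / (2 * tau * (rho+rho)) = rho / tau"
    using rho_bounds(1) tau_pos by (simp add: power2_eq_square)
  finally show ?thesis by (simp add: alpha_def)
next
  assume r: "radius E = rho \<and> radius F = 1"
  have "angle_at (centre D) (centre E) (centre F) =
      arccos (((rho+rho)\<^sup>2 + tau\<^sup>2 - tau\<^sup>2) / (2 * (rho+rho) * tau))"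
    using angle_at_tangent[OF assms(1-3)] r assms(4) rho_bounds(1) by (simp add: one_plus_rho)
  also have "((rho+rho)\<^sup>2 + tau\<^sup>2 - tau\<^sup>2) / (2 * (rho+rho) * tau) = rho / tau"
    using rho_bounds(1) tau_pos by (simp add: power2_eq_square)
  finally show ?thesis by (simp add: alpha_def)
qed

text \<open>These constants confine \<open>3 * alpha / pi\<close> to the open interval from
  \<open>4 / 3\<close> to \<open>3 / 2\<close>, on which the counting of angles relies.\<close>

lemma alpha_bounds: "4 * pi / 9 < alpha" "alpha < pi / 2"
proof -
  define c where "c = rho / tau"
  have "1 < tau" using rho_bounds by (simp add: rho_def)
  then have "rho * 1 < rho * tau" using rho_bounds(1) by (intro mult_strict_left_mono)
  then have "c < rho" using tau_pos by (simp add: c_def pos_divide_less_eq)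
  then have c: "0 < c" "c < 1 / 6" using rho_bounds tau_pos by (simp add: c_def, linarith)
  have cos: "cos alpha = c" unfolding alpha_def c_def[symmetric] using c by (intro cos_arccos) auto
  have "arccos c < arccos 0" using c by (intro arccos_less_arccos) auto
  then show lt: "alpha < pi / 2" by (simp add: alpha_def c_def)
  have ge: "0 \<le> alpha" unfolding alpha_def c_def[symmetric] using c by (intro arccos_lbound) auto
  \<comment> \<open>Puts \<open>3 * alpha - pi\<close> into the range where cosine is decreasing, as
    the comparison below requires.\<close>
  have "pi / 3 < alpha"
  proof (rule ccontr)
    assume "\<not> ?thesis"
    then have "cos (pi / 3) \<le> cos alpha" using ge by (intro cos_monotone_0_pi_le) auto
    then show False using cos c by (simp add: cos_60)
  qed
  \<comment> \<open>The triple angle formula separates \<open>3 alpha\<close> from \<open>4 pi / 3\<close>.\<close>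
  show "4 * pi / 9 < alpha"
  proof (rule ccontr)
    assume "\<not> ?thesis"
    then have "cos (pi / 3) \<le> cos (3 * alpha - pi)"
      using \<open>pi / 3 < alpha\<close> by (intro cos_monotone_0_pi_le) auto
    also have "cos (3 * alpha - pi) = - cos (3 * alpha)" by (simp add: cos_diff)
    also have "\<dots> = 3 * c - 4 * c ^ 3" by (simp add: cos_treble_cos cos)
    also have "\<dots> < 1 / 2" using c zero_less_power[OF c(1), of 3] by linarith
    finally show False by (simp add: cos_60)
  qed
qed

text \<open>In units of \<open>pi / 3\<close> the sum reads \<open>k + b * x = 6\<close>, where
  \<open>b\<close> counts the occurrences of \<open>alpha\<close> and
  \<open>4 / 3 < x < 3 / 2\<close>. This forces \<open>b \<le> 4\<close>, and for \<open>b\<close>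
  from 1 to 4 the product \<open>b * x\<close> lies strictly between consecutive integers. The cases
  2 and 4 use the upper bound on \<open>x\<close>, the case 3 the lower one, in each case
  sharply.\<close>

lemma no_alpha_in_angle_sum:
  assumes "finite I" "\<And>i. i \<in> I \<Longrightarrow> a i \<in> {pi / 3, 2 * pi / 3, alpha}" "sum a I = 2 * pi" "i \<in> I"
  shows "a i \<noteq> alpha"
proof
  assume ai: "a i = alpha"
  have "\<exists>k::nat. sum a I = k * (pi / 3) + card {i \<in> I. a i = alpha} * alpha"
    using assms(1,2)
  proof (induction I rule: finite_induct)
    case (insert i I)
    then obtain k :: nat where k: "sum a I = k * (pi / 3) + card {i \<in> I. a i = alpha} * alpha" by auto
    have s: "sum a (insert i I) = a i + sum a I" using insert by simp
    show ?case
    proof (cases "a i = alpha")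
      case True
      have "{j \<in> insert i I. a j = alpha} = insert i {j \<in> I. a j = alpha}" using True by auto
      then have "card {j \<in> insert i I. a j = alpha} = Suc (card {j \<in> I. a j = alpha})"
        using insert by simp
      then show ?thesis using k s True by (intro exI[of _ k]) (simp add: algebra_simps)
    next
      case False
      then have e: "{j \<in> insert i I. a j = alpha} = {j \<in> I. a j = alpha}" by auto
      consider "a i = pi / 3" | "a i = 2 * pi / 3" using insert.prems[of i] False by auto
      then show ?thesis
      proof cases
        case 1
        then show ?thesis unfolding e s k by (intro exI[of _ "k + 1"]) (simp add: algebra_simps)
      next
        case 2
        then show ?thesis unfolding e s k by (intro exI[of _ "k + 2"]) (simp add: algebra_simps)
      qed
    qed
  qed (auto intro: exI[of _ 0])
  then obtain k :: nat where k: "2 * pi = k * (pi / 3) + card {i \<in> I. a i = alpha} * alpha"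
    using assms(3) by auto
  define b where "b = card {i \<in> I. a i = alpha}"
  define x where "x = alpha * 3 / pi"
  have "b \<noteq> 0" using assms(1,4) ai by (auto simp: b_def)
  have x: "4 / 3 < x" "x < 3 / 2" using alpha_bounds by (simp_all add: x_def field_simps)
  have "pi * (real k + real b * x) = pi * 6" using k by (simp add: x_def b_def field_simps)
  then have kb: "real k + real b * x = 6" by simp
  have "real b * (4 / 3) \<le> real b * x" using x by (intro mult_left_mono) auto
  then have "real b < 5" using kb by linarith
  then have "b = 1 \<or> b = 2 \<or> b = 3 \<or> b = 4" using \<open>b \<noteq> 0\<close> by auto
  then consider "real k + x = 6" | "real k + 2 * x = 6" | "real k + 3 * x = 6" | "real k + 4 * x = 6"
    using kb by auto
  then show False
  proof cases
    case 1
    then have "4 < real k" "real k < 5" using x by linarith+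
    then show False by simp
  next
    case 2
    then have "3 < real k" "real k < 4" using x by linarith+
    then show False by simp
  next
    case 3
    then have "1 < real k" "real k < 2" using x by linarith+
    then show False by simp
  next
    case 4
    then have "0 < real k" "real k < 1" using x by linarith+
    then show False by simp
  qed
qed

section \<open>Local structure of a compact packing with both radii\<close>

locale two_radius_packing =
  fixes P :: "disc set"
  assumes compact: "compact_packing P" and radii: "radius ` P = {1, rho}"
begin

lemma packing: "is_packing P"
  using compact by (simp add: compact_packing_def)

lemma radius_cases: "D \<in> P \<Longrightarrow> radius D = 1 \<or> radius D = rho"
  using radii by auto

lemma touches_self_tangent: "D \<in> P \<Longrightarrow> E \<in> P \<Longrightarrow> touches D v E \<Longrightarrow> tangent D E"
  using touches_tangent packing_radius_pos[OF packing] by blast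

lemma small_neighbours_same:
  assumes D: "D \<in> P" "radius D = rho" and E: "E \<in> P" "tangent D E" and F: "F \<in> P" "tangent D F"
  shows "radius E = radius F"
proof -
  obtain Ds \<theta> where Ds:
    "set Ds = tangent_discs P D" "Ds \<noteq> []"
    "\<And>i. i < length Ds \<Longrightarrow> tangent (Ds ! i) (Ds ! (Suc i mod length Ds))"
    "(\<Sum>i < length Ds. angle_at (centre D) (centre (Ds ! i))
        (centre (Ds ! (Suc i mod length Ds)))) = 2 * pi"
    by (rule compact_packing_chain[OF compact D(1)]) blast
  define a where "a i = angle_at (centre D) (centre (Ds ! i)) (centre (Ds ! (Suc i mod length Ds)))" for i
  have mem: "Ds ! i \<in> P \<and> tangent D (Ds ! i)" if "i < length Ds" for i
    using nth_mem[OF that] Ds(1) by (simp add: tangent_discs_def)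
  have nxt: "Suc i mod length Ds < length Ds" for i using Ds(2) by simp
  have triple: "tangent D (Ds ! i)" "tangent D (Ds ! (Suc i mod length Ds))"
    "tangent (Ds ! i) (Ds ! (Suc i mod length Ds))" if "i < length Ds" for i
    using mem that nxt Ds(3) by auto
  have rad: "radius (Ds ! i) = 1 \<or> radius (Ds ! i) = rho" if "i < length Ds" for i
    using mem[OF that] radius_cases by blast
  have a: "a i \<in> {pi / 3, 2 * pi / 3, alpha}"
    and mixed: "radius (Ds ! i) \<noteq> radius (Ds ! (Suc i mod length Ds)) \<Longrightarrow> a i = alpha"
    if "i < length Ds" for i
    using rad[OF that] rad[OF nxt[of i]] angle_small_units[OF triple[OF that] D(2)]
      angle_small_smalls[OF triple[OF that] D(2)] angle_small_mixed[OF triple[OF that] D(2)]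
    unfolding a_def by auto
  have step: "radius (Ds ! i) = radius (Ds ! (Suc i mod length Ds))" if "i < length Ds" for i
    using no_alpha_in_angle_sum[of "{..<length Ds}" a i] a Ds(4) mixed[OF that] that
    unfolding a_def by blast
  have "radius (Ds ! i) = radius (Ds ! 0)" if "i < length Ds" for i
    using that
  proof (induction i)
    case (Suc i)
    then show ?case using step[of i] by simp
  qed simp
  moreover have "E \<in> set Ds" "F \<in> set Ds" using E F Ds(1) by (auto simp: tangent_discs_def)
  ultimately show ?thesis by (metis in_set_conv_nth)
qed

lemma small_small_rotate:
  assumes D: "D \<in> P" "radius D = rho" and E: "E \<in> P" "radius E = rho" "touches D v E"
  shows "\<exists>F\<in>P. radius F = rho \<and> touches D (v * \<omega> ^ k) F"
proof (induction k)
  case 0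
  then show ?case using E by auto
next
  case (Suc k)
  then obtain F where F: "F \<in> P" "radius F = rho" "touches D (v * \<omega> ^ k) F" by blast
  from next_neighbour[OF compact D(1) F(1,3)] obtain G where G: "G \<in> P" "tangent D G" "tangent F G"
    "touches D (v * \<omega> ^ k * cis (angle_at (centre D) (centre F) (centre G))) G" by blast
  have DF: "tangent D F" using touches_self_tangent D F by blast
  have r: "radius G = rho" using small_neighbours_same[OF D F(1) DF G(1,2)] F by simp
  have "touches D (v * \<omega> ^ k * \<omega>) G"
    using G(4) unfolding angle_small_smalls[OF DF G(2,3) D(2) F(2) r] .
  then show ?case using G(1) r by (auto simp: mult_ac)
qed

text \<open>Around a small disc with a small neighbour, all neighbours are small and form a hexagon, so
  some neighbour of the same kind is closer to a given unit disc by a definite amount.\<close>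

lemma small_neighbour_is_unit:
  assumes D: "D \<in> P" "radius D = rho" and E: "E \<in> P" "tangent D E"
  shows "radius E = 1"
proof (rule ccontr)
  assume "radius E \<noteq> 1"
  then have rE: "radius E = rho" using radius_cases E by blast
  obtain U where U: "U \<in> P" "radius U = 1" using radii by (metis imageE insertI1)
  have rp: "0 < rho" "rho < 1 / 6" using rho_bounds .
  \<comment> \<open>A step of length \<open>2 * rho\<close> within 60 degrees of the direction to
    \<open>U\<close> lowers the squared distance by at least
    \<open>2 * rho * (norm x - 2 * rho)\<close>, and \<open>norm x \<ge> 1 + rho\<close> because the
    discs do not overlap.\<close>
  define \<kappa> where "\<kappa> = 2 * rho * (1 - rho)"
  have \<kappa>: "0 < \<kappa>" using rp by (simp add: \<kappa>_def)
  \<comment> \<open>\<open>n\<close> bounds how many decrements of size \<kappa> remain. The step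
    preserves the hypotheses, with the new disc in place of \<open>D\<close> and the old one as its
    small neighbour; at \<open>n = 0\<close> the squared distance would be negative.\<close>
  have descent: False if "D \<in> P" "radius D = rho" "E \<in> P" "radius E = rho" "tangent D E"
    "(norm (centre U - centre D))\<^sup>2 < real n * \<kappa>" for D E n
    using that
  proof (induction n arbitrary: D E)
    case 0
    then show ?case by (simp add: not_less[symmetric])
  next
    case (Suc n)
    define x where "x = centre U - centre D"
    have ne: "D \<noteq> U" using Suc.prems(2) U rp by auto
    have "tau \<le> norm x"
      using packing_dist_ge[OF packing Suc.prems(1) U(1) ne] Suc.prems(2) U(2)
      by (simp add: x_def dist_norm norm_minus_commute one_plus_rho)
    then have x: "1 + rho \<le> norm x" by (simp add: one_plus_rho)
    obtain v where v: "touches D v E" using tangent_touches Suc.prems rp by force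
    then have "norm v = 1" by (simp add: touches_def)
    then obtain k where k: "(norm (x - of_real (2 * rho) * (v * \<zeta> ^ k)))\<^sup>2 \<le>
        (norm x)\<^sup>2 + (2 * rho)\<^sup>2 - 2 * rho * norm x"
      using three_directions_dist[of v "2 * rho" x] rp by force
    \<comment> \<open>The three directions offered are every second one of the hexagon of small
      neighbours.\<close>
    have "v * \<zeta> ^ k = v * \<omega> ^ (2 * k)" by (simp only: zeta_eq power_mult)
    then obtain F where F: "F \<in> P" "radius F = rho" "touches D (v * \<zeta> ^ k) F"
      using small_small_rotate[OF Suc.prems(1-4) v] by metis
    have eq: "centre U - centre F = x - of_real (2 * rho) * (v * \<zeta> ^ k)"
      using F(2,3) Suc.prems(2) by (simp add: touches_def x_def)
    have "(norm x)\<^sup>2 + (2 * rho)\<^sup>2 - 2 * rho * norm x = (norm x)\<^sup>2 - 2 * rho * (norm x - 2 * rho)"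
      by (simp add: power2_eq_square algebra_simps)
    then have "(norm (centre U - centre F))\<^sup>2 \<le> (norm x)\<^sup>2 - 2 * rho * (norm x - 2 * rho)"
      using k unfolding eq by linarith
    moreover have "2 * rho * (1 - rho) \<le> 2 * rho * (norm x - 2 * rho)"
      using x rp by (intro mult_left_mono) auto
    ultimately have "(norm (centre U - centre F))\<^sup>2 < real n * \<kappa>"
      using Suc.prems(6) by (simp add: x_def \<kappa>_def algebra_simps)
    moreover have "tangent F D" using touches_self_tangent F Suc.prems(1) tangent_sym by blast
    ultimately show ?case using Suc.IH F Suc.prems(1,2) by blast
  qed
  obtain n :: nat where "(norm (centre U - centre D))\<^sup>2 / \<kappa> < n" using reals_Archimedean2 by blast
  then have "(norm (centre U - centre D))\<^sup>2 < real n * \<kappa>" using \<kappa> by (simp add: pos_divide_less_eq)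
  then show False using descent D E rE by blast
qed

definition units :: "disc set" where "units = {D \<in> P. radius D = 1}"

lemma unit_packing_units: "unit_packing units"
  using packing by (auto simp: unit_packing_def units_def is_packing_def pairwise_def)

text \<open>After a small neighbour comes a unit one, so a step across a small disc is two turns of
  \<open>pi / 6\<close>, together again \<open>pi / 3\<close>.\<close>

lemma unit_next:
  assumes "D \<in> units" "E \<in> units" "touches D v E"
  shows "\<exists>F\<in>units. touches D (v * \<omega>) F"
proof -
  have D: "D \<in> P" "radius D = 1" and E: "E \<in> P" "radius E = 1" using assms by (auto simp: units_def)
  have DE: "tangent D E" using touches_self_tangent D E assms(3) by blast
  from next_neighbour[OF compact D(1) E(1) assms(3)] obtain F where F: "F \<in> P" "tangent D F" "tangent E F"
    "touches D (v * cis (angle_at (centre D) (centre E) (centre F))) F" by blast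
  show ?thesis
  proof (cases "radius F = 1")
    case True
    then show ?thesis using F angle_unit_unit[OF DE F(2,3) D(2) E(2)] by (auto simp: units_def)
  next
    case False
    then have rF: "radius F = rho" using radius_cases F by blast
    then have tF: "touches D (v * cis (pi / 6)) F"
      using F angle_unit_mixed[OF DE F(2,3) D(2)] E(2) by simp
    from next_neighbour[OF compact D(1) F(1) tF] obtain G where G: "G \<in> P" "tangent D G" "tangent F G"
      "touches D (v * cis (pi / 6) * cis (angle_at (centre D) (centre F) (centre G))) G" by blast
    have rG: "radius G = 1" using small_neighbour_is_unit[OF F(1) rF G(1,3)] .
    have "touches D (v * cis (pi / 6) * cis (pi / 6)) G"
      using G angle_unit_mixed[OF F(2) G(2,3) D(2)] rF rG by simp
    then show ?thesis using G rG by (auto simp: units_def mult.assoc cis_mult)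
  qed
qed

lemma hexagonal_units: "hexagonal units"
proof -
  have "\<exists>E\<in>units. tangent D E" if "D \<in> units" for D
  proof -
    have D: "D \<in> P" "radius D = 1" using that by (auto simp: units_def)
    obtain E where E: "E \<in> P" "tangent D E" using neighbour_exists[OF compact D(1)] by blast
    show ?thesis
    proof (cases "radius E = 1")
      case False
      then have rE: "radius E = rho" using radius_cases E by blast
      obtain v where "touches D v E" using tangent_touches E packing_radius_pos[OF packing] D by blast
      \<comment> \<open>The next neighbour of \<open>D\<close> also touches the small disc
        \<open>E\<close>, hence is a unit disc.\<close>
      from next_neighbour[OF compact D(1) E(1) this] obtain F where "F \<in> P" "tangent D F" "tangent E F" by blast
      then show ?thesis using small_neighbour_is_unit[OF E(1) rE] by (auto simp: units_def)
    qed (use E in \<open>auto simp: units_def\<close>)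
  qed
  moreover have "units \<noteq> {}"
  proof -
    have "1 \<in> radius ` P" using radii by simp
    then show ?thesis by (auto simp: units_def)
  qed
  ultimately show ?thesis using unit_packing_units unit_next unfolding hexagonal_def by blast
qed

lemma pocket_small:
  assumes D: "D \<in> P" "radius D = rho"
  shows "pocket units D"
proof -
  obtain E where E: "E \<in> P" "tangent D E" using neighbour_exists[OF compact D(1)] by blast
  obtain v where v: "touches D v E" using tangent_touches E packing_radius_pos[OF packing] D by blast
  have "\<exists>A\<in>units. touches D (v * \<zeta> ^ k) A" for k
  proof (induction k)
    case 0
    then show ?case using E v small_neighbour_is_unit[OF D E] by (auto simp: units_def)
  next
    case (Suc k)
    then obtain A where A: "A \<in> P" "radius A = 1" "touches D (v * \<zeta> ^ k) A" by (auto simp: units_def)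
    from next_neighbour[OF compact D(1) A(1,3)] obtain F where F: "F \<in> P" "tangent D F" "tangent A F"
      "touches D (v * \<zeta> ^ k * cis (angle_at (centre D) (centre A) (centre F))) F" by blast
    have DA: "tangent D A" using touches_self_tangent D A by blast
    have rF: "radius F = 1" using small_neighbour_is_unit[OF D F(1,2)] .
    then show ?case using F angle_small_units[OF DA F(2,3) D(2) A(2) rF]
      by (auto simp: units_def mult_ac)
  qed
  then show ?thesis using v D(2) unfolding pocket_def touches_def by blast
qed

end


section \<open>Holes around pockets\<close>

definition hole_at :: "disc set \<Rightarrow> disc \<Rightarrow> complex set" where
  "hole_at T G = connected_component_set (- (\<Union>D\<in>T. region D)) (centre G)"

definition corners :: "disc set \<Rightarrow> disc \<Rightarrow> disc set" where
  "corners T G = {A \<in> T. tangent G A}"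

text \<open>The segment has length 2, so each of its points is within 1 of an end. These segments
  wall off a hole.\<close>

lemma segment_covered:
  assumes "tangent A B" "radius A = 1" "radius B = 1" "x \<in> closed_segment (centre A) (centre B)"
  shows "x \<in> region A \<union> region B"
proof -
  have "dist (centre A) x + dist x (centre B) = 2"
    using assms between_mem_segment[of "centre A" "centre B" x] by (simp add: between tangent_def)
  then have "dist (centre A) x \<le> 1 \<or> dist (centre B) x \<le> 1" by (simp add: dist_commute) linarith
  then show ?thesis using assms by (simp add: region_def)
qed

lemma tangent_of_angle:
  assumes "touches D v E" "touches D (v * cis \<delta>) F" "0 < radius E" "0 < radius F"
    and "(radius E + radius F)\<^sup>2 = (radius D + radius E)\<^sup>2 + (radius D + radius F)\<^sup>2
      - 2 * (radius D + radius E) * (radius D + radius F) * cos \<delta>"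
  shows "tangent E F"
proof -
  have "norm v = 1" using assms(1) by (simp add: touches_def)
  then have "(dist (centre E) (centre F))\<^sup>2 = (radius E + radius F)\<^sup>2"
    unfolding dist_touches_sq[OF assms(1,2)] assms(5) by (simp only: cnj_mult_cis)
  then show ?thesis
    using assms(3,4) by (simp add: tangent_def)
qed

lemma small_side:
  assumes "radius G = rho" "radius E = 1" "radius F = 1" "touches G w E" "touches G (w * \<zeta>) F"
  shows "tangent E F"
proof (rule tangent_of_angle[OF assms(4,5)])
  have "tau\<^sup>2 + tau\<^sup>2 - 2 * tau * tau * cos (2 * pi / 3) = 3 * tau\<^sup>2"
    by (simp add: cos_120 power2_eq_square)
  then show "(radius E + radius F)\<^sup>2 = (radius G + radius E)\<^sup>2 + (radius G + radius F)\<^sup>2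
      - 2 * (radius G + radius E) * (radius G + radius F) * cos (2 * pi / 3)"
    unfolding assms(1-3) one_plus_rho by (simp only: tau_sq) simp
qed (use assms in simp_all)

text \<open>Translates directions into the triangle of corners. The barycentre formula lets the
  small disc be recovered from its corners, and the last clause keeps all other unit discs away from
  the hole.\<close>

lemma pocket_corners:
  assumes T: "unit_packing T" and G: "pocket T G"
  obtains A B C where "corners T G = {A, B, C}" "tangent A B" "tangent B C" "tangent C A"
    "centre G = (centre A + centre B + centre C) / 3"
    "\<forall>E\<in>T. dist (centre G) (centre E) < 2 * tau \<longrightarrow> E \<in> {A, B, C}"
proof -
  have P: "is_packing T" using T by (simp add: unit_packing_def)
  obtain v where rG: "radius G = rho" and v: "norm v = 1" "\<And>k. \<exists>A\<in>T. touches G (v * \<zeta> ^ k) A"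
    using G unfolding pocket_def by blast
  obtain f where f: "\<And>k::nat. f k \<in> T \<and> touches G (v * \<zeta> ^ k) (f k)" using v(2) by metis
  have rf: "radius (f k) = 1" for k using f T by (auto simp: unit_packing_def)
  have near: "E \<in> {f 0, f 1, f 2}" if E: "E \<in> T" "dist (centre G) (centre E) < 2 * tau" for E
  proof -
    obtain k where k: "k < 3" "touches G (v * \<zeta> ^ k) E"
      using pocket_nearest[OF T rG v E] by blast
    then have "E = f k" using touches_inj[OF P E(1), of "f k"] f by blast
    moreover have "k = 0 \<or> k = 1 \<or> k = 2" using k(1) by auto
    ultimately show ?thesis by auto
  qed
  have tf: "tangent G (f k)" for k
    using touches_tangent[of G "v * \<zeta> ^ k" "f k"] f[of k] rf[of k] rG rho_bounds(1) by simp
  have df: "dist (centre G) (centre (f k)) = tau" for k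
    using tf[of k] rG rf by (simp add: tangent_def one_plus_rho)
  have "corners T G = {f 0, f 1, f 2}"
  proof
    show "corners T G \<subseteq> {f 0, f 1, f 2}"
    proof
      fix E assume "E \<in> corners T G"
      then have E: "E \<in> T" "tangent G E" by (auto simp: corners_def)
      then have "radius E = 1" using T by (simp add: unit_packing_def)
      then have "dist (centre G) (centre E) < 2 * tau"
        using E rG tau_pos by (simp add: tangent_def one_plus_rho)
      then show "E \<in> {f 0, f 1, f 2}" using near E by blast
    qed
    show "{f 0, f 1, f 2} \<subseteq> corners T G" using f tf by (auto simp: corners_def)
  qed
  moreover have side: "tangent (f j) (f (j + 1))" for j
  proof (rule small_side[OF rG])
    show "touches G (v * \<zeta> ^ j * \<zeta>) (f (j + 1))" using f[of "j + 1"] by (simp add: mult_ac)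
  qed (use f rf in auto)
  moreover have "tangent (f 2) (f 0)"
  proof -
    \<comment> \<open>Three turns of 120 degrees return to the first corner, which closes the
      triangle.\<close>
    have "touches G (v * \<zeta> ^ 3) (f 3)" using f by blast
    then have "touches G (v * \<zeta> ^ 0) (f 3)" unfolding zeta_cube by simp
    then have "f 3 = f 0" using touches_inj[OF P, of "f 3" "f 0"] f by blast
    then show ?thesis using side[of 2] by simp
  qed
  moreover have "centre G = (centre (f 0) + centre (f 1) + centre (f 2)) / 3"
  proof -
    have c: "centre (f k) = centre G + of_real tau * (v * \<zeta> ^ k)" for k
      using f[of k] rG rf by (simp add: touches_def one_plus_rho flip: of_real_add)
    \<comment> \<open>The displacements from \<open>G\<close> to the three corners cancel.\<close>
    have "1 + \<zeta> + \<zeta>\<^sup>2 = 0" unfolding zeta_square by (simp add: zeta_Complex complex_eq_iff)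
    then have "of_real tau * v * (1 + \<zeta> + \<zeta>\<^sup>2) = 0" by simp
    then show ?thesis unfolding c by (simp add: algebra_simps)
  qed
  ultimately show thesis using that[of "f 0" "f 1" "f 2"] side[of 0] side[of 1] near by (simp add: numeral_2_eq_2)
qed

text \<open>The sides of the triangle spanned by the three centres are covered by the three discs, so the
  component of the complement around the small disc cannot leave this triangle.\<close>

lemma hole_at_pocket:
  assumes T: "unit_packing T" and G: "pocket T G"
    and free: "\<And>E. E \<in> T \<Longrightarrow> tau \<le> dist (centre G) (centre E)"
  shows "hole_at T G \<in> holes T" "bounding_discs T (hole_at T G) = corners T G"
    "put_into_hole T (hole_at T G) G"
proof -
  obtain A B C where ABC: "corners T G = {A, B, C}" "tangent A B" "tangent B C" "tangent C A"
    and g: "centre G = (centre A + centre B + centre C) / 3"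
    and near: "\<forall>E\<in>T. dist (centre G) (centre E) < 2 * tau \<longrightarrow> E \<in> {A, B, C}"
    using pocket_corners[OF T G] by blast
  have rG: "radius G = rho" using G by (simp add: pocket_def)
  have in_T: "A \<in> T" "B \<in> T" "C \<in> T" using ABC(1) by (auto simp: corners_def)
  then have r: "radius A = 1" "radius B = 1" "radius C = 1" using T by (auto simp: unit_packing_def)
  define U where "U = (\<Union>D\<in>T. region D)"
  define H where "H = hole_at T G"
  define K where "K = convex hull {centre A, centre B, centre C}"
  have H: "H = connected_component_set (- U) (centre G)" by (simp add: H_def hole_at_def U_def)
  \<comment> \<open>Unit centres are at least \<open>tau = 1 + rho\<close> from
    \<open>centre G\<close>, so the open small disc misses all unit discs.\<close>
  have ball: "ball (centre G) rho \<subseteq> - U"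
  proof
    fix x assume x: "x \<in> ball (centre G) rho"
    have "x \<notin> region E" if "E \<in> T" for E
    proof
      assume "x \<in> region E"
      then have "dist (centre E) x \<le> 1" using that T by (simp add: region_def unit_packing_def)
      moreover have "dist (centre G) (centre E) \<le> dist (centre G) x + dist (centre E) x"
        by (metis dist_commute dist_triangle)
      ultimately show False using free[OF that] x by (simp add: rho_def)
    qed
    then show "x \<in> - U" by (simp add: U_def)
  qed
  have gU: "centre G \<in> - U" using ball rho_bounds(1) centre_in_ball by blast
  have ballH: "ball (centre G) rho \<subseteq> H"
    unfolding H using ball rho_bounds(1) by (intro connected_component_maximal) auto
  have comp: "H \<in> components (- U)" unfolding H using gU by (rule componentsI)
  have connH: "connected H" and HU: "H \<inter> U = {}"
    using in_components_connected[OF comp] in_components_subset[OF comp] by auto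
  have frK: "frontier K \<subseteq> U"
  proof
    fix x assume "x \<in> frontier K"
    then have "x \<in> closed_segment (centre A) (centre B) \<or> x \<in> closed_segment (centre B) (centre C)
        \<or> x \<in> closed_segment (centre C) (centre A)"
      unfolding K_def by (subst (asm) frontier_of_triangle) auto
    then have "x \<in> region A \<union> region B \<union> region C"
      using segment_covered ABC(2-4) r by blast
    then show "x \<in> U" using in_T by (auto simp: U_def)
  qed
  have "centre G \<in> K"
    unfolding K_def convex_hull_3
    by (rule CollectI, intro exI[of _ "1/3"]) (simp add: g scaleR_conv_of_real add_divide_distrib)
  moreover have "centre G \<in> H" using ballH rho_bounds(1) centre_in_ball by blast
  ultimately have HK: "H \<subseteq> K"
    using connected_Int_frontier[OF connH, of K] frK HU by blast
  have compK: "compact K" unfolding K_def by (rule finite_imp_compact_convex_hull) simp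
  have bdd: "bounded H" using HK compK bounded_subset compact_imp_bounded by blast
  have clH: "closure H \<subseteq> K" using HK compK by (simp add: closure_minimal compact_imp_closed)
  have dABC: "dist (centre G) (centre X) = tau" if "X \<in> {A, B, C}" for X
  proof -
    have "X \<in> corners T G" using that ABC(1) by simp
    then show ?thesis using rG T by (auto simp: corners_def tangent_def unit_packing_def one_plus_rho)
  qed
  \<comment> \<open>The circle about \<open>centre G\<close> through the corners encloses
    \<open>K\<close>. A unit disc meeting the closure of \<open>H\<close> thus has its centre within
    \<open>tau + 1 < 2 * tau\<close> of \<open>centre G\<close>, where only the corners are.\<close>
  have Kball: "K \<subseteq> cball (centre G) tau"
    unfolding K_def using dABC by (intro hull_minimal) auto
  have "X \<in> corners T G" if X: "X \<in> T" "region X \<inter> frontier H \<noteq> {}" for X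
  proof -
    obtain p where p: "p \<in> region X" "p \<in> frontier H" using X by blast
    have "p \<in> K" using p(2) clH by (auto simp: frontier_def)
    then have "dist (centre G) p \<le> tau" using Kball by auto
    moreover have "dist (centre X) p \<le> 1" using p X T by (simp add: region_def unit_packing_def)
    moreover have "dist (centre G) (centre X) \<le> dist (centre G) p + dist (centre X) p"
      by (metis dist_commute dist_triangle)
    moreover have "1 < tau" using rho_bounds by (simp add: rho_def)
    ultimately have "dist (centre G) (centre X) < 2 * tau" by linarith
    then show ?thesis using near X ABC(1) by blast
  qed
  moreover have "region X \<inter> frontier H \<noteq> {}" if X: "X \<in> corners T G" for X
  proof -
    have XT: "X \<in> T" and rX: "radius X = 1" and d: "dist (centre G) (centre X) = tau"
      using X T dABC ABC(1) by (auto simp: corners_def unit_packing_def)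
    define u where "u = (centre X - centre G) / of_real tau"
    have u: "norm u = 1" "centre X = centre G + of_real tau * u"
      using d tau_pos by (auto simp: u_def norm_divide dist_norm norm_minus_commute)
    \<comment> \<open>The point of tangency of \<open>G\<close> and \<open>X\<close>: it is a limit
      of points of the open small disc, which lies in \<open>H\<close>, but belongs to
      \<open>X\<close>.\<close>
    define q where "q = centre G + of_real rho * u"
    have "dist (centre X) q = norm (of_real (tau - rho) * u)"
      by (simp add: q_def u dist_norm algebra_simps)
    also have "\<dots> = 1" using u by (simp add: rho_def)
    finally have qX: "q \<in> region X" using rX by (simp add: region_def)
    have "dist (centre G) q = rho" using rho_bounds(1) u by (simp add: q_def dist_norm norm_mult)
    then have "q \<in> closure (ball (centre G) rho)" using rho_bounds(1) by (simp add: closure_ball)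
    then have "q \<in> closure H" using ballH closure_mono by blast
    moreover have "q \<notin> H" using HU qX XT by (auto simp: U_def)
    ultimately have "q \<in> frontier H" using interior_subset by (auto simp: frontier_def)
    then show ?thesis using qX by blast
  qed
  ultimately have bd: "bounding_discs T H = corners T G"
    unfolding bounding_discs_def by (auto simp: corners_def)
  then show "bounding_discs T (hole_at T G) = corners T G" by (simp add: H_def)
  show "hole_at T G \<in> holes T"
    using comp bdd bd ABC tangent_sym unfolding holes_def H_def[symmetric] U_def by blast
  show "put_into_hole T (hole_at T G) G"
    using ballH bd unfolding put_into_hole_def H_def[symmetric]
    by (auto simp: region_def rG corners_def)
qed

text \<open>The lattice consists of the unit discs, and \<open>S\<close> of the components
  containing the centres of small discs. Distinct small discs give distinct holes: a hole determines
  its bounding discs, and these determine the centre as their barycentre.\<close>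

lemma (in two_radius_packing) arises_from_lattice:
  "\<exists>T S. triangular_lattice_packing T \<and> S \<subseteq> holes T \<and> S \<noteq> {} \<and> filled_packing rho T S P"
proof -
  define smalls where "smalls = {D \<in> P. radius D = rho}"
  have U: "unit_packing units" by (rule unit_packing_units)
  have free: "tau \<le> dist (centre G) (centre E)" if "G \<in> smalls" "E \<in> units" for G E
  proof -
    have "G \<noteq> E" using that rho_bounds by (auto simp: smalls_def units_def)
    then show ?thesis
      using packing_dist_ge[OF packing, of G E] that by (auto simp: smalls_def units_def one_plus_rho)
  qed
  have pocket: "pocket units G" if "G \<in> smalls" for G using pocket_small that by (simp add: smalls_def)
  note hole = hole_at_pocket[OF U pocket free]
  have inj: "inj_on (hole_at units) smalls"
  proof (rule inj_onI)
    fix G G' assume G: "G \<in> smalls" "G' \<in> smalls" "hole_at units G = hole_at units G'"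
    have c: "corners units G = corners units G'"
      using hole(2)[of G] hole(2)[of G'] G by simp
    have r: "radius G = rho" "radius G' = rho" using G by (auto simp: smalls_def)
    obtain A B C where A: "corners units G = {A, B, C}" "tangent A B" "tangent B C" "tangent C A"
      "centre G = (centre A + centre B + centre C) / 3"
      using pocket_corners[OF U pocket[OF G(1)]] .
    obtain A' B' C' where A': "corners units G' = {A', B', C'}" "tangent A' B'" "tangent B' C'" "tangent C' A'"
      "centre G' = (centre A' + centre B' + centre C') / 3"
      using pocket_corners[OF U pocket[OF G(2)]] .
    have "\<And>X. X \<in> units \<Longrightarrow> \<not> tangent X X" by (simp add: tangent_def units_def)
    moreover have "{A, B, C} \<subseteq> units" "{A', B', C'} \<subseteq> units" using A(1) A'(1) by (auto simp: corners_def)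
    \<comment> \<open>A sum over the corner set counts each centre once, so the three corners must
      be known to differ.\<close>
    ultimately have d: "A \<noteq> B" "B \<noteq> C" "C \<noteq> A" "A' \<noteq> B'" "B' \<noteq> C'" "C' \<noteq> A'"
      using A A' by auto
    have "centre A + centre B + centre C = sum centre (corners units G)" using A(1) d by simp
    moreover have "centre A' + centre B' + centre C' = sum centre (corners units G')" using A'(1) d by simp
    ultimately have "centre G = centre G'" using A(5) A'(5) c by metis
    then show "G = G'" using disc_eqI r by simp
  qed
  define S where "S = hole_at units ` smalls"
  define f where "f = inv_into smalls (hole_at units)"
  have "S \<subseteq> holes units" using hole(1) by (auto simp: S_def)
  moreover have "S \<noteq> {}"
  proof -
    have "rho \<in> radius ` P" using radii by simp
    then show ?thesis by (auto simp: S_def smalls_def)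
  qed
  moreover have "filled_packing rho units S P"
    unfolding filled_packing_def
  proof (intro exI[of _ f] conjI ballI)
    fix H assume "H \<in> S"
    then obtain G where G: "G \<in> smalls" "H = hole_at units G" by (auto simp: S_def)
    then have fH: "f H = G" using inj by (simp add: f_def inv_into_f_f)
    then show "radius (f H) = rho" using G by (simp add: smalls_def)
    show "put_into_hole units H (f H)" using hole(3) G fH by simp
  next
    have "f ` S = smalls" using inj by (simp add: f_def S_def inv_into_image_cancel)
    then show "P = units \<union> f ` S" using radius_cases by (auto simp: units_def smalls_def)
  qed
  ultimately show ?thesis using hexagonal_triangular[OF hexagonal_units] by blast
qed


section \<open>Filled lattices are compact packings\<close>

lemma direction_at_120:
  assumes "norm v = 1" "norm w = 1" "Re (cnj v * w) = - 1 / 2"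
  shows "w = v * \<zeta> \<or> w = v * \<zeta>\<^sup>2"
proof -
  define y where "y = cnj v * w"
  have vv: "v * cnj v = 1" using assms(1) complex_norm_square[of v] by simp
  then have w: "w = v * y" by (simp only: y_def mult.assoc[symmetric] mult_1)
  have "norm y = 1" using assms by (simp add: y_def norm_mult)
  then have "(- 1 / 2)\<^sup>2 + (Im y)\<^sup>2 = 1" using cmod_power2[of y] assms(3) by (simp add: y_def)
  then have "(Im y)\<^sup>2 = (sqrt 3 / 2)\<^sup>2" by (simp add: power_divide)
  then have "Im y = sqrt 3 / 2 \<or> Im y = - sqrt 3 / 2" unfolding power2_eq_iff by simp
  then have "y = \<zeta> \<or> y = \<zeta>\<^sup>2"
    using assms(3) unfolding zeta_square unfolding zeta_Complex complex_eq_iff y_def[symmetric] by simp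
  then show ?thesis using w by auto
qed

lemma direction_of_tangent_units:
  assumes "radius G = rho" "radius E = 1" "radius F = 1" "touches G v E" "touches G w F" "tangent E F"
  shows "Re (cnj v * w) = - 1 / 2"
proof -
  define q where "q = Re (cnj v * w)"
  have "2\<^sup>2 = tau\<^sup>2 + tau\<^sup>2 - 2 * tau * tau * Re (cnj v * w)"
    using dist_touches_sq[OF assms(4,5)] assms(6) unfolding tangent_def assms(1-3) one_plus_rho by simp
  also have "2 * tau * tau = 2 * tau\<^sup>2" by (simp add: power2_eq_square)
  finally show ?thesis unfolding tau_sq q_def[symmetric] by simp
qed

text \<open>Seen from \<open>G\<close>, any two of the three mutually tangent discs are 120 degrees
  apart. The orientation is unknown, so the second and third directions are
  \<open>v * \<zeta>\<close> and \<open>v * \<zeta>\<^sup>2\<close> in either order; tangency of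
  \<open>B\<close> and \<open>C\<close> makes them differ.\<close>

lemma put_into_hole_pocket:
  assumes T: "unit_packing T" and H: "H \<in> holes T" and G: "radius G = rho" "put_into_hole T H G"
  shows "pocket T G"
proof -
  obtain A B C where ABC: "tangent A B" "tangent B C" "tangent A C" "bounding_discs T H = {A, B, C}"
    using H by (auto simp: holes_def)
  have in_T: "A \<in> T" "B \<in> T" "C \<in> T" using ABC(4) by (auto simp: bounding_discs_def)
  then have r: "radius A = 1" "radius B = 1" "radius C = 1" using T by (auto simp: unit_packing_def)
  have "tangent G A" "tangent G B" "tangent G C" using G(2) ABC(4) by (auto simp: put_into_hole_def)
  then obtain v w u where t: "touches G v A" "touches G w B" "touches G u C"
    using tangent_touches G(1) rho_bounds(1) r by (metis zero_less_one)
  have n: "norm v = 1" "norm w = 1" "norm u = 1" using t by (auto simp: touches_def)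
  have "w = v * \<zeta> \<or> w = v * \<zeta>\<^sup>2" "u = v * \<zeta> \<or> u = v * \<zeta>\<^sup>2"
    using direction_at_120 n direction_of_tangent_units[OF G(1)] r t ABC by blast+
  moreover have "w \<noteq> u"
  proof
    assume "w = u"
    then have "Re (cnj w * (w * cis 0)) = - 1 / 2"
      using direction_of_tangent_units[OF G(1) r(2,3) t(2,3) ABC(2)] by simp
    then show False using cnj_mult_cis[OF n(2), of 0] by simp
  qed
  ultimately have ex: "\<exists>X\<in>T. touches G (v * \<zeta>) X" "\<exists>X\<in>T. touches G (v * \<zeta>\<^sup>2) X"
    using t in_T by blast+
  have "\<exists>X\<in>T. touches G (v * \<zeta> ^ k) X" for k
  proof -
    have "\<zeta> ^ k = (\<zeta> ^ 3) ^ (k div 3) * \<zeta> ^ (k mod 3)"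
      by (simp only: power_mult[symmetric] power_add[symmetric] mult_div_mod_eq)
    then have "\<zeta> ^ k = \<zeta> ^ (k mod 3)" unfolding zeta_cube by simp
    moreover have "k mod 3 = 0 \<or> k mod 3 = 1 \<or> k mod 3 = 2" by linarith
    ultimately show ?thesis using ex t(1) in_T(1) by (metis mult.right_neutral power_0 power_one_right)
  qed
  then show ?thesis using G(1) n(1) unfolding pocket_def by blast
qed

lemma finite_touches:
  assumes "is_packing P"
  shows "finite {E \<in> P. touches D z E}"
proof -
  have "{E \<in> P. touches D z E} \<subseteq> {THE E. E \<in> P \<and> touches D z E}"
  proof
    fix E assume "E \<in> {E \<in> P. touches D z E}"
    then have "(THE E. E \<in> P \<and> touches D z E) = E"
      using touches_inj[OF assms] by (intro the_equality) auto
    then show "E \<in> {THE E. E \<in> P \<and> touches D z E}" by simp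
  qed
  then show ?thesis using finite_subset by blast
qed

lemma tangent_60:
  assumes "radius D = 1" "radius E = 1" "radius F = 1" "touches D v E" "touches D (v * \<omega>) F"
  shows "tangent E F"
  by (rule tangent_of_angle[OF assms(4,5)]) (simp_all add: assms(1-3) cos_60)

lemma tangent_30:
  assumes "radius D = 1" "radius E = 1 \<and> radius F = rho \<or> radius E = rho \<and> radius F = 1"
    "touches D v E" "touches D (v * cis (pi / 6)) F"
  shows "tangent E F"
proof (rule tangent_of_angle[OF assms(3,4)])
  have "tau * sqrt 3 = 2" by (simp add: tau_def)
  then have *: "(1 + 1)\<^sup>2 + tau\<^sup>2 - 2 * (1 + 1) * tau * cos (pi / 6) = tau\<^sup>2"
    "tau\<^sup>2 + (1 + 1)\<^sup>2 - 2 * tau * (1 + 1) * cos (pi / 6) = tau\<^sup>2"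
    by (simp_all add: cos_30 algebra_simps)
  from assms(2) show "(radius E + radius F)\<^sup>2 = (radius D + radius E)\<^sup>2 + (radius D + radius F)\<^sup>2
      - 2 * (radius D + radius E) * (radius D + radius F) * cos (pi / 6)"
    using * assms(1) by (elim disjE conjE) (simp_all only: one_plus_rho)
qed (use assms rho_bounds(1) in auto)

locale filled_lattice =
  fixes T :: "disc set" and S :: "complex set set" and f :: "complex set \<Rightarrow> disc"
  assumes hex: "hexagonal T" and S: "S \<subseteq> holes T" "S \<noteq> {}"
    and f: "\<And>H. H \<in> S \<Longrightarrow> radius (f H) = rho" "\<And>H. H \<in> S \<Longrightarrow> put_into_hole T H (f H)"
begin

definition filled :: "disc set" where "filled = T \<union> f ` S"

lemma unit: "unit_packing T"
  using hex by (simp add: hexagonal_def)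

lemma radius_T: "D \<in> T \<Longrightarrow> radius D = 1"
  using unit by (simp add: unit_packing_def)

lemma radius_small: "G \<in> f ` S \<Longrightarrow> radius G = rho"
  using f(1) by auto

lemma pocket_small: "G \<in> f ` S \<Longrightarrow> pocket T G"
  using put_into_hole_pocket[OF unit] S(1) f by blast

text \<open>The interior of an inserted disc lies in its hole, which misses all unit discs, and
  different holes are disjoint as components.\<close>

lemma packing_filled: "is_packing filled"
proof -
  have T: "is_packing T" using unit by (simp add: unit_packing_def)
  have pos: "0 < radius D" if "D \<in> filled" for D
    using that radius_T radius_small rho_bounds(1) by (auto simp: filled_def)
  have hole: "interior (region (f H)) \<subseteq> H" "H \<in> components (- (\<Union>D\<in>T. region D))" if "H \<in> S" for H
    using f(2)[OF that] S(1) that by (auto simp: put_into_hole_def holes_def)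
  have TS: "disjnt (interior (region E)) (interior (region (f H)))" if "H \<in> S" "E \<in> T" for H E
  proof -
    have "interior (region E) \<subseteq> (\<Union>D\<in>T. region D)" using interior_subset that(2) by blast
    then show ?thesis using hole[OF that(1)] in_components_subset by (fastforce simp: disjnt_iff)
  qed
  have SS: "disjnt (interior (region (f H))) (interior (region (f H')))"
    if "H \<in> S" "H' \<in> S" "f H \<noteq> f H'" for H H'
  proof -
    have "H \<inter> H' = {}"
      using components_nonoverlap[OF hole(2)[OF that(1)] hole(2)[OF that(2)]] that(3) by blast
    then show ?thesis using hole(1) that by (fastforce simp: disjnt_iff)
  qed
  have "pairwise (\<lambda>D E. disjnt (interior (region D)) (interior (region E))) filled"
    unfolding pairwise_def filled_def
    using T TS SS disjnt_sym unfolding is_packing_def pairwise_def by blast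
  then show ?thesis using pos by (simp add: is_packing_def)
qed

text \<open>Tangent small discs would have centres at distance \<open>2 * rho < tau\<close>, too
  close for two distinct pocket centres.\<close>

lemma not_tangent_small:
  assumes "G \<in> f ` S" "G' \<in> f ` S"
  shows "\<not> tangent G G'"
proof
  assume t: "tangent G G'"
  then have d: "dist (centre G) (centre G') = 2 * rho" using assms radius_small by (simp add: tangent_def)
  then have "centre G = centre G'"
    using pockets_apart[OF unit] pocket_small assms rho_bounds by (simp add: rho_def)
  then show False using d rho_bounds(1) by simp
qed

lemma touches_small:
  assumes "G \<in> f ` S" "E \<in> filled" "touches G w E"
  shows "E \<in> T"
proof -
  have "0 < radius G" "0 < radius E"
    using packing_radius_pos[OF packing_filled] assms by (auto simp: filled_def)
  then have "tangent G E" using touches_tangent assms(3) by blast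
  then show ?thesis using assms not_tangent_small by (auto simp: filled_def)
qed

lemma small_directions:
  assumes "G \<in> f ` S"
  obtains v where "norm v = 1" "\<And>k. \<exists>A\<in>T. touches G (v * \<zeta> ^ k) A"
    "\<And>E w. E \<in> T \<Longrightarrow> touches G w E \<Longrightarrow> \<exists>k<3. w = v * \<zeta> ^ k"
proof -
  have rG: "radius G = rho" using radius_small assms .
  obtain v where v: "norm v = 1" "\<And>k. \<exists>A\<in>T. touches G (v * \<zeta> ^ k) A"
    using pocket_small[OF assms] unfolding pocket_def by blast
  moreover have "\<exists>k<3. w = v * \<zeta> ^ k" if E: "E \<in> T" "touches G w E" for E w
  proof -
    have pos: "0 < radius G" "0 < radius E" using rG radius_T E rho_bounds(1) by auto
    have "tangent G E" using touches_tangent E(2) pos .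
    then have "dist (centre G) (centre E) < 2 * tau"
      using rG radius_T[OF E(1)] tau_pos by (simp add: tangent_def one_plus_rho)
    then obtain k where "k < 3" "touches G (v * \<zeta> ^ k) E"
      using pocket_nearest[OF unit rG v E(1)] by blast
    then show ?thesis using touches_unique[OF E(2) _ pos] by blast
  qed
  ultimately show thesis using that by blast
qed

lemma chain_small:
  assumes G: "G \<in> f ` S"
  shows "\<exists>Ds. distinct Ds \<and> set Ds = tangent_discs filled G \<and>
        cyclic_order (centre G) (map centre Ds) \<and>
        (\<forall>i < length Ds. tangent (Ds ! i) (Ds ! (Suc i mod length Ds))) \<and>
        surrounds Ds G"
proof (rule compact_chainI[OF packing_filled])
  have rG: "radius G = rho" using radius_small G .
  obtain v where v: "norm v = 1" "\<And>k. \<exists>A\<in>T. touches G (v * \<zeta> ^ k) A"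
    "\<And>E w. E \<in> T \<Longrightarrow> touches G w E \<Longrightarrow> \<exists>k<3. w = v * \<zeta> ^ k"
    using small_directions[OF G] by metis
  show GF: "G \<in> filled" using G by (simp add: filled_def)
  have pos: "0 < radius E" if "E \<in> filled" for E using packing_radius_pos[OF packing_filled that] .
  have "tangent_discs filled G \<subseteq> (\<Union>k\<in>{..<3}. {E \<in> filled. touches G (v * \<zeta> ^ k) E})"
  proof
    fix E assume "E \<in> tangent_discs filled G"
    then have E: "E \<in> filled" "tangent G E" by (auto simp: tangent_discs_def)
    then obtain w where w: "touches G w E" using tangent_touches pos GF by blast
    then show "E \<in> (\<Union>k\<in>{..<3}. {E \<in> filled. touches G (v * \<zeta> ^ k) E})"
      using v(3)[OF touches_small[OF G E(1) w] w] E(1) by blast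
  qed
  moreover have "finite (\<Union>k\<in>{..<3}. {E \<in> filled. touches G (v * \<zeta> ^ k) E})"
    using finite_touches[OF packing_filled] by simp
  ultimately show "finite (tangent_discs filled G)" by (rule finite_subset)
  obtain A where "A \<in> T" "touches G (v * \<zeta> ^ 0) A" using v(2) by blast
  then have "A \<in> tangent_discs filled G"
    using touches_tangent pos GF by (auto simp: tangent_discs_def filled_def)
  then show "tangent_discs filled G \<noteq> {}" by blast
  show "\<exists>F\<in>filled. \<exists>\<delta>. 0 < \<delta> \<and> \<delta> < pi \<and> tangent E F \<and> touches G (w * cis \<delta>) F \<and>
        (\<forall>X\<in>filled. \<forall>\<epsilon>. 0 < \<epsilon> \<and> \<epsilon> < \<delta> \<longrightarrow> \<not> touches G (w * cis \<epsilon>) X)"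
    if E: "E \<in> filled" "touches G w E" for E w
  proof -
    have ET: "E \<in> T" using touches_small[OF G E] .
    obtain k where k: "w = v * \<zeta> ^ k" using v(3)[OF ET E(2)] by blast
    obtain F where F: "F \<in> T" "touches G (v * \<zeta> ^ Suc k) F" using v(2) by blast
    then have tF: "touches G (w * \<zeta>) F" by (simp add: k mult_ac)
    have "tangent E F" using small_side[OF rG radius_T[OF ET] radius_T[OF F(1)] E(2) tF] .
    moreover have "\<not> touches G (w * cis \<epsilon>) X" if X: "X \<in> filled" and \<epsilon>: "0 < \<epsilon>" "\<epsilon> < 2 * pi / 3" for X \<epsilon>
    proof
      assume t: "touches G (w * cis \<epsilon>) X"
      obtain j where j: "w * cis \<epsilon> = v * \<zeta> ^ j" using v(3)[OF touches_small[OF G X t] t] by blast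
      \<comment> \<open>Cubing erases the powers of \<open>\<zeta>\<close>, so both directions have
        the cube \<open>v ^ 3\<close>; this would make \<open>3 * \<epsilon>\<close>, which lies
        strictly between 0 and \<open>2 * pi\<close>, a full turn.\<close>
      have cube: "(\<zeta> ^ i) ^ 3 = 1" for i
        by (metis mult.commute power_mult power_one zeta_cube)
      have w3: "w ^ 3 = v ^ 3" by (simp only: k power_mult_distrib cube mult_1_right)
      have "(w * cis \<epsilon>) ^ 3 = v ^ 3 * 1" by (simp only: j power_mult_distrib cube)
      then have "v ^ 3 * cis \<epsilon> ^ 3 = v ^ 3 * 1" unfolding power_mult_distrib w3 .
      moreover have "v ^ 3 \<noteq> 0" using v(1) by auto
      ultimately have "cis \<epsilon> ^ 3 = 1" using mult_left_cancel by blast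
      then have "cis (3 * \<epsilon>) = cis 0" by (simp add: Complex.DeMoivre)
      then show False using cis_eqD[of "3 * \<epsilon>" 0] \<epsilon> by auto
    qed
    ultimately show ?thesis
      using F(1) tF by (intro bexI[of _ F] exI[of _ "2 * pi / 3"]) (auto simp: filled_def)
  qed
qed

text \<open>Seen from \<open>G\<close>, the disc \<open>D\<close> lies in direction
  \<open>- u\<close> and the other two corners at \<open>- u * \<zeta>\<close> and
  \<open>- u * \<zeta>\<^sup>2\<close>. Moving the origin back to \<open>D\<close> gives the
  displacement \<open>u * tau * (1 - z)\<close> for \<open>z = \<zeta>\<close> and
  \<open>z = \<zeta>\<^sup>2\<close>, which has length 2 and direction turned from \<open>u\<close>
  by \<open>pi / 6\<close> either way.\<close>

lemma small_between_units:
  assumes D: "D \<in> T" and G: "G \<in> f ` S" "touches D u G"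
  shows "\<exists>B\<in>T. touches D (u * cis (- (pi / 6))) B" "\<exists>C\<in>T. touches D (u * cis (pi / 6)) C"
proof -
  have rG: "radius G = rho" using radius_small G(1) .
  have rD: "radius D = 1" using radius_T D .
  have cG: "centre G = centre D + of_real tau * u" and u: "norm u = 1"
    using G(2) unfolding touches_def rG rD one_plus_rho by auto
  have "touches G (- u) D" using cG u unfolding touches_def rG rD one_plus_rho by simp
  obtain v where v: "\<And>k. \<exists>A\<in>T. touches G (v * \<zeta> ^ k) A"
    "\<And>E w. E \<in> T \<Longrightarrow> touches G w E \<Longrightarrow> \<exists>k<3. w = v * \<zeta> ^ k"
    using small_directions[OF G(1)] by metis
  obtain k where k: "- u = v * \<zeta> ^ k" using v(2)[OF D \<open>touches G (- u) D\<close>] by blast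
  have rot: "touches D (u * c) A" if A: "A \<in> T" "touches G (- u * z) A"
    and c: "of_real tau * (1 - z) = 2 * c" "norm c = 1" for A z c
  proof -
    have rA: "radius A = 1" using radius_T A(1) .
    have "centre A = centre D + u * (of_real tau * (1 - z))"
      using A(2) cG unfolding touches_def rG rA one_plus_rho by (simp add: algebra_simps)
    then show ?thesis using c u rD rA by (simp add: touches_def norm_mult)
  qed
  have t: "tau * sqrt 3 = 2" by (simp add: tau_def)
  have 1: "of_real tau * (1 - \<zeta>) = 2 * cis (- (pi / 6))"
    unfolding zeta_Complex cis_minus_pi_sixth complex_eq_iff using t by (simp add: tau_def)
  have 2: "of_real tau * (1 - \<zeta>\<^sup>2) = 2 * cis (pi / 6)"
    unfolding zeta_square cis_pi_sixth complex_eq_iff using t by (simp add: tau_def)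
  have "- u * \<zeta> = v * \<zeta> ^ (k + 1)" "- u * \<zeta>\<^sup>2 = v * \<zeta> ^ (k + 2)"
    unfolding k by (simp_all only: power_add power_one_right mult.assoc)
  then obtain B C where "B \<in> T" "touches G (- u * \<zeta>) B" "C \<in> T" "touches G (- u * \<zeta>\<^sup>2) C"
    using v(1) by metis
  then show "\<exists>B\<in>T. touches D (u * cis (- (pi / 6))) B" "\<exists>C\<in>T. touches D (u * cis (pi / 6)) C"
    using rot[OF _ _ 1] rot[OF _ _ 2] norm_cis by blast+
qed

text \<open>Within the next 60 degrees there is no unit neighbour. A small one at turn \<epsilon>
  has unit neighbours of \<open>D\<close> at \<open>\<epsilon> - pi / 6\<close> and
  \<open>\<epsilon> + pi / 6\<close>, which leaves only \<open>\<epsilon> = pi / 6\<close>. The next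
  disc is that small one if present, and otherwise the unit disc at 60 degrees.\<close>

lemma next_of_unit:
  assumes D: "D \<in> T" and E: "E \<in> T" "touches D v E"
  shows "\<exists>F\<in>filled. \<exists>\<delta>. 0 < \<delta> \<and> \<delta> < pi \<and> tangent E F \<and> touches D (v * cis \<delta>) F \<and>
        (\<forall>X\<in>filled. \<forall>\<epsilon>. 0 < \<epsilon> \<and> \<epsilon> < \<delta> \<longrightarrow> \<not> touches D (v * cis \<epsilon>) X)"
proof -
  have apart: False if "X \<in> T" "touches D (v * cis \<epsilon>) X" "0 < \<epsilon>" "\<epsilon> < pi / 3" for X \<epsilon>
    using unit_neighbours_apart[OF unit D E(1) that(1) E(2) that(2-)] .
  have small: "\<epsilon> = pi / 6" if X: "X \<in> f ` S" "touches D (v * cis \<epsilon>) X" "0 < \<epsilon>" "\<epsilon> < pi / 3" for X \<epsilon>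
  proof -
    obtain B C where "B \<in> T" "touches D (v * cis (\<epsilon> - pi / 6)) B" "C \<in> T" "touches D (v * cis (\<epsilon> + pi / 6)) C"
      using small_between_units[OF D X(1,2)] by (auto simp: mult.assoc cis_mult)
    then have "\<not> (0 < \<epsilon> - pi / 6 \<and> \<epsilon> - pi / 6 < pi / 3)" "\<not> (0 < \<epsilon> + pi / 6 \<and> \<epsilon> + pi / 6 < pi / 3)"
      using apart by blast+
    then show ?thesis using X(3,4) pi_gt_zero by linarith
  qed
  show ?thesis
  proof (cases "\<exists>G\<in>f ` S. touches D (v * cis (pi / 6)) G")
    case True
    then obtain G where G: "G \<in> f ` S" "touches D (v * cis (pi / 6)) G" by blast
    have "tangent E G" using tangent_30[OF _ _ E(2) G(2)] radius_T radius_small D E(1) G(1) by blast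
    moreover have "\<not> touches D (v * cis \<epsilon>) X" if "X \<in> filled" "0 < \<epsilon>" "\<epsilon> < pi / 6" for X \<epsilon>
    proof
      assume "touches D (v * cis \<epsilon>) X"
      moreover have "\<epsilon> < pi / 3" using that(3) pi_gt_zero by linarith
      ultimately show False using that small[of X \<epsilon>] apart[of X \<epsilon>] by (auto simp: filled_def)
    qed
    ultimately show ?thesis
      using G by (intro bexI[of _ G] exI[of _ "pi / 6"]) (auto simp: filled_def)
  next
    case False
    obtain F where F: "F \<in> T" "touches D (v * \<omega>) F"
      using hex D E unfolding hexagonal_def by blast
    have "tangent E F" using tangent_60[OF _ _ _ E(2) F(2)] radius_T D E(1) F(1) by blast
    moreover have "\<not> touches D (v * cis \<epsilon>) X" if X: "X \<in> filled" "0 < \<epsilon>" "\<epsilon> < pi / 3" for X \<epsilon>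
    proof
      assume t: "touches D (v * cis \<epsilon>) X"
      then have "X \<in> f ` S" using X apart by (auto simp: filled_def)
      then show False using small[OF _ t X(2,3)] t False by blast
    qed
    ultimately show ?thesis
      using F by (intro bexI[of _ F] exI[of _ "pi / 3"]) (auto simp: filled_def)
  qed
qed

text \<open>The unit disc \<open>F\<close> at \<open>pi / 6\<close> comes next: a unit disc before
  it would be too close to \<open>F\<close>, and a small disc at turn \<epsilon> would bring a
  further unit disc only \<epsilon> beyond \<open>F\<close>.\<close>

lemma next_of_small:
  assumes D: "D \<in> T" and E: "E \<in> f ` S" "touches D v E"
  shows "\<exists>F\<in>filled. \<exists>\<delta>. 0 < \<delta> \<and> \<delta> < pi \<and> tangent E F \<and> touches D (v * cis \<delta>) F \<and>
        (\<forall>X\<in>filled. \<forall>\<epsilon>. 0 < \<epsilon> \<and> \<epsilon> < \<delta> \<longrightarrow> \<not> touches D (v * cis \<epsilon>) X)"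
proof -
  obtain F where F: "F \<in> T" "touches D (v * cis (pi / 6)) F"
    using small_between_units(2)[OF D E] by blast
  have "tangent E F" using tangent_30[OF _ _ E(2) F(2)] radius_T radius_small D E(1) F(1) by blast
  moreover have "\<not> touches D (v * cis \<epsilon>) X" if X: "X \<in> filled" and \<epsilon>: "0 < \<epsilon>" "\<epsilon> < pi / 6" for X \<epsilon>
  proof
    assume t: "touches D (v * cis \<epsilon>) X"
    show False
    proof (cases "X \<in> T")
      case True
      have "touches D (v * cis \<epsilon> * cis (pi / 6 - \<epsilon>)) F" using F(2) by (simp add: mult.assoc cis_mult)
      moreover have "0 < pi / 6 - \<epsilon>" "pi / 6 - \<epsilon> < pi / 3" using \<epsilon> pi_gt_zero by linarith+
      ultimately show False using unit_neighbours_apart[OF unit D True F(1) t] by blast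
    next
      case False
      then have "X \<in> f ` S" using X by (auto simp: filled_def)
      then obtain C where C: "C \<in> T" "touches D (v * cis \<epsilon> * cis (pi / 6)) C"
        using small_between_units(2)[OF D _ t] by blast
      then have "touches D (v * cis (pi / 6) * cis \<epsilon>) C" by (simp add: mult_ac)
      moreover have "\<epsilon> < pi / 3" using \<epsilon> pi_gt_zero by linarith
      ultimately show False using unit_neighbours_apart[OF unit D F(1) C(1) F(2)] \<epsilon>(1) by blast
    qed
  qed
  ultimately show ?thesis
    using F by (intro bexI[of _ F] exI[of _ "pi / 6"]) (auto simp: filled_def)
qed

lemma chain_unit:
  assumes D: "D \<in> T"
  shows "\<exists>Ds. distinct Ds \<and> set Ds = tangent_discs filled D \<and>
        cyclic_order (centre D) (map centre Ds) \<and>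
        (\<forall>i < length Ds. tangent (Ds ! i) (Ds ! (Suc i mod length Ds))) \<and>
        surrounds Ds D"
proof (rule compact_chainI[OF packing_filled])
  show DF: "D \<in> filled" using D by (simp add: filled_def)
  have pos: "0 < radius E" if "E \<in> filled" for E using packing_radius_pos[OF packing_filled that] .
  obtain A where A: "A \<in> T" "tangent D A" using hex D unfolding hexagonal_def by blast
  then show "tangent_discs filled D \<noteq> {}" by (auto simp: tangent_discs_def filled_def)
  obtain v where v: "touches D v A" using tangent_touches[OF A(2)] pos DF A(1) unfolding filled_def by blast
  \<comment> \<open>The unit neighbours occupy at most six directions, and turning the direction of
    a small neighbour by \<open>pi / 6\<close> gives one of these. So there are finitely many
    candidate directions, each carrying at most one disc.\<close>
  define Z where "Z = (\<lambda>k. v * \<omega> ^ k) ` {..<6}"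
  have Z: "z \<in> Z" if "E \<in> T" "touches D z E" for E z
    using hexagonal_direction[OF hex D A(1) v that] by (auto simp: Z_def)
  have "tangent_discs filled D \<subseteq>
      (\<Union>z\<in>Z \<union> (\<lambda>z. z * cis (- (pi / 6))) ` Z. {E \<in> filled. touches D z E})"
  proof
    fix E assume "E \<in> tangent_discs filled D"
    then have E: "E \<in> filled" "tangent D E" by (auto simp: tangent_discs_def)
    then obtain w where w: "touches D w E" using tangent_touches pos DF by blast
    have "w \<in> Z \<union> (\<lambda>z. z * cis (- (pi / 6))) ` Z"
    proof (cases "E \<in> T")
      case False
      then have "E \<in> f ` S" using E(1) by (auto simp: filled_def)
      then obtain C where "C \<in> T" "touches D (w * cis (pi / 6)) C"
        using small_between_units(2)[OF D _ w] by blast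
      then have "w * cis (pi / 6) \<in> Z" using Z by blast
      moreover have "w = w * cis (pi / 6) * cis (- (pi / 6))" by (simp add: mult.assoc cis_mult)
      ultimately show ?thesis by blast
    qed (use Z w in blast)
    then show "E \<in> (\<Union>z\<in>Z \<union> (\<lambda>z. z * cis (- (pi / 6))) ` Z. {E \<in> filled. touches D z E})"
      using E(1) w by blast
  qed
  moreover have "finite Z" by (simp add: Z_def)
  ultimately show "finite (tangent_discs filled D)"
    using finite_touches[OF packing_filled] by (elim finite_subset) simp
  show "\<exists>F\<in>filled. \<exists>\<delta>. 0 < \<delta> \<and> \<delta> < pi \<and> tangent E F \<and> touches D (w * cis \<delta>) F \<and>
        (\<forall>X\<in>filled. \<forall>\<epsilon>. 0 < \<epsilon> \<and> \<epsilon> < \<delta> \<longrightarrow> \<not> touches D (w * cis \<epsilon>) X)"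
    if "E \<in> filled" "touches D w E" for E w
    using that next_of_unit[OF D] next_of_small[OF D] unfolding filled_def by blast
qed

lemma compact_filled: "compact_packing_using 1 rho filled"
proof -
  have "compact_packing filled"
    unfolding compact_packing_def using packing_filled chain_unit chain_small by (auto simp: filled_def)
  moreover have "radius ` filled = {1, rho}"
  proof -
    have "T \<noteq> {}" using hex by (simp add: hexagonal_def)
    then have "radius ` T = {1}" using radius_T by auto
    moreover have "radius ` f ` S = {rho}" using radius_small S(2) by auto
    ultimately show ?thesis unfolding filled_def image_Un by auto
  qed
  ultimately show ?thesis by (simp add: compact_packing_using_def)
qed

end

theorem mainTheorem4:
  fixes r :: real
  assumes "r = 2 * sqrt 3 / 3 - 1"
  shows "{P. compact_packing_using 1 r P} =
    {P. \<exists>T S. triangular_lattice_packing T \<and> S \<subseteq> holes T \<and> S \<noteq> {} \<and> filled_packing r T S P}"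
proof -
  have r: "r = rho" using assms by (simp add: rho_def tau_def)
  have "\<exists>T S. triangular_lattice_packing T \<and> S \<subseteq> holes T \<and> S \<noteq> {} \<and> filled_packing rho T S P"
    if "compact_packing_using 1 rho P" for P
  proof -
    interpret two_radius_packing P
      using that by unfold_locales (auto simp: compact_packing_using_def)
    show ?thesis by (rule arises_from_lattice)
  qed
  moreover have "compact_packing_using 1 rho P"
    if TS: "triangular_lattice_packing T" "S \<subseteq> holes T" "S \<noteq> {}" "filled_packing rho T S P" for P T S
  proof -
    obtain f where fS: "\<And>H. H \<in> S \<Longrightarrow> radius (f H) = rho \<and> put_into_hole T H (f H)" "P = T \<union> f ` S"
      using TS(4) unfolding filled_packing_def by blast
    interpret filled_lattice T S f
      using TS fS(1) triangular_hexagonal by unfold_locales auto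
    show ?thesis using compact_filled fS(2) by (simp add: filled_def)
  qed
  ultimately show ?thesis unfolding r by blast
qed

end
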